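(* Let $N\ge2$, $0<R\le\infty$, and let $(r^{N-1}V,r^{N-1}W)$ be a Bessel pair on $(0,R)$ with positive solution $f$ on $(0,R)$. Then for all radial functions $u\in C_c^\infty(B_R\setminus\{x_0\})$, $$\begin{aligned}\int_{B_R}V(r)|\Delta_{\mathbb{H}^N}u|^2\,dv_{\mathbb{H}^N}={}&\int_{B_R}W(r)|\nabla_{\mathbb{H}^N}u|^2\,dv_{\mathbb{H}^N}\\&+(N-1)\int_{B_R}\left(\frac{V(r)}{\sinh^2 r}-\frac{V_r(r)\cosh r}{\sinh r}\right)|\nabla_{\mathbb{H}^N}u|^2\,dv_{\mathbb{H}^N}\\&-(N-1)\int_{B_R}V(r)\frac{f'(r)}{f(r)}\left(\coth r-\frac1r\right)|\nabla_{\mathbb{H}^N}u|^2\,dv_{\mathbb{H}^N}\\&+\int_{B_R}V(r)(f(r))^2\left|\nabla_{\mathbb{H}^N}\left(\frac{u_r}{f(r)}\right)\right|^2dv_{\mathbb{H}^N}.\end{aligned}$$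
   Context: $\mathbb{H}^N$ is the $N$-dimensional hyperbolic space (constant curvature $-1$) with Riemannian volume $dv_{\mathbb{H}^N}$, Laplace-Beltrami operator $\Delta_{\mathbb{H}^N}$ and Riemannian gradient $\nabla_{\mathbb{H}^N}$; $x_0\in\mathbb{H}^N$ is a fixed pole, $r=d(x,x_0)$ is the geodesic distance, $B_R$ is the geodesic ball of radius $R$ centered at $x_0$ ($B_\infty=\mathbb{H}^N$). A function is radial if it depends only on $r$; functions are real-valued; $u_r=\frac{\partial u}{\partial r}$ and $V_r=V'$. A pair $(\tilde V,\tilde W)$ of $C^1$ functions is a Bessel pair on $(0,R)$ if the ordinary differential equation $(\tilde V y')'+\tilde W y=0$ admits a positive solution on $(0,R)$. Thus here $V,W$ are $C^1$ functions on $(0,R)$ and $f>0$ satisfies $(r^{N-1}Vf')'+r^{N-1}Wf=0$ on $(0,R)$. *)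

theory Defs
  imports "HOL-Analysis.Analysis"
begin

section \<open>Hyperbolic space\<close>

text \<open>
  Hyperbolic space of dimension \<open>N = DIM('a)\<close> is realised as the Poincare ball: the open unit
  ball with the metric \<open>g = \<lambda>\<^sup>2 g_eucl\<close>, \<open>\<lambda>(x) = 2 / (1 - |x|\<^sup>2)\<close>, of constant curvature -1.
  Tangent vectors at a point are identified with elements of \<open>'a\<close>.
\<close>

definition hyp_space :: "'a::euclidean_space set" where
  "hyp_space = ball 0 1"

definition conf_factor :: "'a::euclidean_space \<Rightarrow> real" where
  "conf_factor x = 2 / (1 - (norm x)\<^sup>2)"

definition hmetric :: "'a::euclidean_space \<Rightarrow> 'a \<Rightarrow> 'a \<Rightarrow> real" where
  "hmetric x v w = (conf_factor x)\<^sup>2 * (v \<bullet> w)"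

definition hnorm :: "'a::euclidean_space \<Rightarrow> 'a \<Rightarrow> real" where
  "hnorm x v = sqrt (hmetric x v v)"

text \<open>
  The geodesic distance is the infimum of Riemannian lengths over \<open>C\<^sup>1\<close> curves.  The predicate
  \<open>piecewise_C1_differentiable_on\<close> is deliberately not used: it allows derivatives that blow up
  at the break points, so the length integral need not exist and would then default to 0.
\<close>

definition curve_length :: "(real \<Rightarrow> 'a::euclidean_space) \<Rightarrow> real" where
  "curve_length \<gamma> = integral {0..1} (\<lambda>t. hnorm (\<gamma> t) (vector_derivative \<gamma> (at t)))"

definition hdist :: "'a::euclidean_space \<Rightarrow> 'a \<Rightarrow> real" where
  "hdist x y = Inf {curve_length \<gamma> |\<gamma>. \<gamma> C1_differentiable_on {0..1} \<and>
     \<gamma> ` {0..1} \<subseteq> hyp_space \<and> \<gamma> 0 = x \<and> \<gamma> 1 = y}"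

definition hball :: "'a::euclidean_space \<Rightarrow> ereal \<Rightarrow> 'a set" where
  "hball x0 R = {x \<in> hyp_space. ereal (hdist x0 x) < R}"

text \<open>\<open>dv = sqrt (det g) dx = \<lambda>\<^sup>N dx\<close>\<close>

definition hvol :: "'a::euclidean_space measure" where
  "hvol = density (restrict_space lborel hyp_space) (\<lambda>x. ennreal (conf_factor x ^ DIM('a)))"

definition partial_deriv :: "'a::euclidean_space \<Rightarrow> ('a \<Rightarrow> real) \<Rightarrow> 'a \<Rightarrow> real" where
  "partial_deriv b u x = frechet_derivative u (at x) b"

text \<open>
  In coordinates \<open>(grad u)\<^sup>i = g\<^sup>i\<^sup>j \<partial>\<^sub>j u\<close> with \<open>g\<^sup>i\<^sup>j = \<lambda>\<^sup>-\<^sup>2 \<delta>\<^sup>i\<^sup>j\<close>, and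
  \<open>div X = (det g)\<^sup>-\<^sup>1\<^sup>/\<^sup>2 \<partial>\<^sub>i ((det g)\<^sup>1\<^sup>/\<^sup>2 X\<^sup>i)\<close>; the Laplace-Beltrami operator is \<open>div grad\<close>.
\<close>

definition hgrad :: "('a::euclidean_space \<Rightarrow> real) \<Rightarrow> 'a \<Rightarrow> 'a" where
  "hgrad u x = (\<Sum>b\<in>Basis. (partial_deriv b u x / (conf_factor x)\<^sup>2) *\<^sub>R b)"

definition hdiv :: "('a::euclidean_space \<Rightarrow> 'a) \<Rightarrow> 'a \<Rightarrow> real" where
  "hdiv X x = (\<Sum>b\<in>Basis. partial_deriv b (\<lambda>y. conf_factor y ^ DIM('a) * (X y \<bullet> b)) x)
     / conf_factor x ^ DIM('a)"

definition hlaplacian :: "('a::euclidean_space \<Rightarrow> real) \<Rightarrow> 'a \<Rightarrow> real" where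
  "hlaplacian u = hdiv (hgrad u)"

section \<open>Test functions\<close>

text \<open>Intended for open \<open>S\<close> (derivatives are taken in full neighbourhoods).\<close>

fun Ck_on :: "nat \<Rightarrow> ('a::euclidean_space \<Rightarrow> real) \<Rightarrow> 'a set \<Rightarrow> bool" where
  "Ck_on 0 u S \<longleftrightarrow> continuous_on S u"
| "Ck_on (Suc k) u S \<longleftrightarrow>
     (\<forall>x\<in>S. u differentiable (at x)) \<and> (\<forall>b\<in>Basis. Ck_on k (partial_deriv b u) S)"

text \<open>
  Elements of \<open>C_c\<^sup>\<infinity>(\<Omega>)\<close> are extended by zero to the whole space.  For \<open>\<Omega>\<close> inside the ball,
  hyperbolic and Euclidean smoothness, closure (of the support) and compactness agree.
\<close>

definition test_functions :: "'a::euclidean_space set \<Rightarrow> ('a \<Rightarrow> real) set" where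
  "test_functions \<Omega> = {u. (\<forall>k. Ck_on k u \<Omega>) \<and>
     compact (closure {x. u x \<noteq> 0}) \<and> closure {x. u x \<noteq> 0} \<subseteq> \<Omega>}"

section \<open>Bessel pairs\<close>

text \<open>
  Solutions of \<open>(V y')' + W y = 0\<close> on \<open>(0,R)\<close> are required to be \<open>C\<^sup>1\<close> with \<open>V y'\<close>
  differentiable; this includes all \<open>C\<^sup>2\<close> solutions, and no sign of \<open>V\<close> is assumed.
\<close>

definition positive_solution ::
  "(real \<Rightarrow> real) \<Rightarrow> (real \<Rightarrow> real) \<Rightarrow> ereal \<Rightarrow> (real \<Rightarrow> real) \<Rightarrow> bool" where
  "positive_solution V W R y \<longleftrightarrow>
     (\<forall>r\<in>einterval 0 R. y r > 0) \<and>
     y C1_differentiable_on einterval 0 R \<and>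
     (\<forall>r\<in>einterval 0 R. (\<lambda>s. V s * deriv y s) differentiable (at r) \<and>
        deriv (\<lambda>s. V s * deriv y s) r + W r * y r = 0)"

definition bessel_pair :: "(real \<Rightarrow> real) \<Rightarrow> (real \<Rightarrow> real) \<Rightarrow> ereal \<Rightarrow> bool" where
  "bessel_pair V W R \<longleftrightarrow>
     V C1_differentiable_on einterval 0 R \<and> W C1_differentiable_on einterval 0 R \<and>
     (\<exists>y. positive_solution V W R y)"

end

theory Submission
  imports Defs
begin

text \<open>
  With \<open>d\<close> the distance to the pole and \<open>n = N - 1\<close>, the difference of the two integrands equals
  the hyperbolic divergence of the compactly supported radial field \<open>h(d) sinh d \<nabla>d\<close>, where
  \<open>h = n V v\<^sup>2 cosh / sinh\<^sup>2 + V f' v\<^sup>2 / (f sinh)\<close> and \<open>v = u\<^sub>r\<close>: its two summands are the boundary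
  terms of the two integrations by parts that a reduction to one variable would use. Polar
  coordinates are therefore not needed, only \<open>|\<nabla>d| = 1\<close> and \<open>\<Delta> cosh d = N cosh d\<close>, which come from the
  formula \<open>cosh d(a, x) = 1 + 2 |x - a|\<^sup>2 / ((1 - |x|\<^sup>2)(1 - |a|\<^sup>2))\<close>, and the fact that a partial
  derivative of a compactly supported function integrates to 0, which follows from translation
  invariance of Lebesgue measure and dominated convergence.
\<close>

section \<open>The hyperbolic cosine of the distance\<close>

text \<open>The third integral comes from a mismatch of weights: the Bessel equation carries
  \<open>r ^ (N - 1)\<close>, the volume \<open>sinh r ^ (N - 1)\<close>. Dividing the equation by
  its weight gives \<open>(V f')' = - W f - (N - 1) / r * V f'\<close>, whereas integrating against
  the volume produces \<open>(N - 1) coth r * V f'\<close>; together they leave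
  \<open>(N - 1) (coth r - 1 / r) V f'\<close>. The boundary term with \<open>f\<close> comes from
  \<open>v = f w\<close> and \<open>V (v')^2 = V f^2 (w')^2 + V f' (f w^2)'\<close>, the other one
  from the cross term of \<open>(v' + (N - 1) v coth r)^2\<close>. Three obstacles shape the work.
  \<open>hdist\<close> is an infimum over curves, so its closed form needs a bound for all curves
  and a curve attaining it. No regularity is assumed of the profile \<open>\<phi>\<close>; it is
  recovered by restricting \<open>u\<close> to a geodesic ray. And \<open>f\<close> need not be
  twice differentiable where \<open>V\<close> vanishes, so \<open>V f'\<close> is always
  differentiated as a single function.\<close>

definition hcosh :: "'a::euclidean_space \<Rightarrow> 'a \<Rightarrow> real" where
  "hcosh a x = 1 + 2 * ((x - a) \<bullet> (x - a)) / ((1 - x \<bullet> x) * (1 - a \<bullet> a))"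

text \<open>The Euclidean gradient; the Riemannian one is this vector divided by
  \<open>(conf_factor x)\<^sup>2\<close>.\<close>

definition hcosh_grad :: "'a::euclidean_space \<Rightarrow> 'a \<Rightarrow> 'a" where
  "hcosh_grad a x = (4 / (1 - a \<bullet> a)) *\<^sub>R
     ((1 / (1 - x \<bullet> x)) *\<^sub>R (x - a) + (((x - a) \<bullet> (x - a)) / (1 - x \<bullet> x)\<^sup>2) *\<^sub>R x)"

text \<open>The Euclidean Hessian applied to \<open>v\<close>, without Christoffel terms.\<close>

definition hcosh_hess :: "'a::euclidean_space \<Rightarrow> 'a \<Rightarrow> 'a \<Rightarrow> 'a" where
  "hcosh_hess a x v = (4 / (1 - a \<bullet> a)) *\<^sub>R
     ((1 / (1 - x \<bullet> x)) *\<^sub>R v + (2 * (x \<bullet> v) / (1 - x \<bullet> x)\<^sup>2) *\<^sub>R (x - a)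
      + (2 * ((x - a) \<bullet> v) / (1 - x \<bullet> x)\<^sup>2 + 4 * ((x - a) \<bullet> (x - a)) * (x \<bullet> v) / (1 - x \<bullet> x) ^ 3) *\<^sub>R x
      + (((x - a) \<bullet> (x - a)) / (1 - x \<bullet> x)\<^sup>2) *\<^sub>R v)"

lemma hyp_space_iff: "x \<in> hyp_space \<longleftrightarrow> x \<bullet> x < 1"
  by (simp add: hyp_space_def norm_lt_square)

lemma open_hyp_space: "open hyp_space"
  by (simp add: hyp_space_def)

lemma conf_factor_inner: "conf_factor x = 2 / (1 - x \<bullet> x)"
  by (simp add: conf_factor_def power2_norm_eq_inner)

lemma conf_factor_pos: "x \<in> hyp_space \<Longrightarrow> 0 < conf_factor x"
  by (simp add: conf_factor_inner hyp_space_iff)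

lemma hcosh_ge_1: "x \<in> hyp_space \<Longrightarrow> a \<in> hyp_space \<Longrightarrow> 1 \<le> hcosh a x"
  by (simp add: hcosh_def hyp_space_iff)

lemma hcosh_gt_1: "x \<in> hyp_space \<Longrightarrow> a \<in> hyp_space \<Longrightarrow> x \<noteq> a \<Longrightarrow> 1 < hcosh a x"
  by (simp add: hcosh_def hyp_space_iff)

lemma hcosh_self: "hcosh a a = 1"
  by (simp add: hcosh_def)

lemma has_derivative_one_minus_inner:
  fixes x :: "'a::euclidean_space"
  shows "((\<lambda>x. 1 - x \<bullet> x) has_derivative (\<lambda>v. - 2 * (x \<bullet> v))) (at x)"
  by (rule derivative_eq_intros refl)+ (auto simp: inner_commute)

lemma has_derivative_inner_diff_self:
  fixes x a :: "'a::euclidean_space"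
  shows "((\<lambda>x. (x - a) \<bullet> (x - a)) has_derivative (\<lambda>v. 2 * ((x - a) \<bullet> v))) (at x)"
  by (rule derivative_eq_intros refl)+ (auto simp: inner_commute)

lemma has_derivative_hcosh:
  assumes "x \<in> hyp_space" "a \<in> hyp_space"
  shows "(hcosh a has_derivative (\<lambda>v. hcosh_grad a x \<bullet> v)) (at x)"
proof -
  define n m k where "n = (x - a) \<bullet> (x - a)" and "m = 1 - x \<bullet> x" and "k = 1 - a \<bullet> a"
  have nz: "m \<noteq> 0" "k \<noteq> 0" using assms by (auto simp: hyp_space_iff m_def k_def)
  have D: "((\<lambda>y. 1 + (2 / k) * (((y - a) \<bullet> (y - a)) / (1 - y \<bullet> y))) has_derivative
       (\<lambda>v. 0 + (2 / k) * ((2 * ((x - a) \<bullet> v) * m - n * (- 2 * (x \<bullet> v))) / (m * m)))) (at x)"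
    using nz unfolding n_def m_def
    by (intro has_derivative_add has_derivative_mult_right has_derivative_divide' has_derivative_const
        has_derivative_one_minus_inner has_derivative_inner_diff_self)
  have E: "hcosh_grad a x \<bullet> v = (4 / k) * (((x - a) \<bullet> v) / m + n * (x \<bullet> v) / m\<^sup>2)" for v
    unfolding hcosh_grad_def inner_scaleR_left inner_add_left by (fold n_def m_def k_def) simp
  show ?thesis
    unfolding hcosh_def [abs_def]
    apply (fold k_def)
    apply (rule has_derivative_eq_rhs [OF has_derivative_transform [OF _ _ D]])
      apply simp
     apply simp
    apply (rule ext)
    unfolding E
    using nz apply (simp add: field_simps power2_eq_square)
    done
qed

text \<open>In metric terms this is \<open>|\<nabla> cosh d| = sinh d\<close>, equivalent to
  \<open>|\<nabla>d| = 1\<close> away from the pole. All scalar products reduce to the three numbers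
  \<open>n\<close>, \<open>m\<close>, \<open>k\<close>.\<close>

lemma norm_hcosh_grad:
  assumes "x \<in> hyp_space" "a \<in> hyp_space"
  shows "hcosh_grad a x \<bullet> hcosh_grad a x = (conf_factor x)\<^sup>2 * ((hcosh a x)\<^sup>2 - 1)"
proof -
  define n m k T where "n = (x - a) \<bullet> (x - a)" and "m = 1 - x \<bullet> x" and "k = 1 - a \<bullet> a"
    and "T = x \<bullet> (x - a)"
  have nz: "m \<noteq> 0" "k \<noteq> 0" using assms by (auto simp: hyp_space_iff m_def k_def)
  have X: "x \<bullet> x = 1 - m" and T': "(x - a) \<bullet> x = T" by (simp_all add: m_def T_def inner_commute)
  \<comment> \<open>Polarisation: \<open>2 x . (x - a) = |x - a|^2 + |x|^2 - |a|^2\<close>.\<close>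
  have T: "T = (n + k - m) / 2" by (simp add: T_def n_def k_def m_def inner_simps inner_commute)
  have "hcosh_grad a x \<bullet> hcosh_grad a x = (4 / k) * ((1 / m) * ((4 / k) * ((1 / m) * n + (n / m\<^sup>2) * T))
      + (n / m\<^sup>2) * ((4 / k) * ((1 / m) * T + (n / m\<^sup>2) * (1 - m))))"
    unfolding hcosh_grad_def inner_scaleR_left inner_scaleR_right inner_add_left inner_add_right
    by (fold n_def k_def m_def) (simp only: X T' T_def [symmetric] n_def [symmetric])
  also have "\<dots> = (2 / m)\<^sup>2 * ((1 + 2 * n / (m * k))\<^sup>2 - 1)"
    unfolding T using nz by (simp add: field_simps power2_eq_square)
  finally show ?thesis
    by (simp only: hcosh_def conf_factor_inner n_def m_def k_def)
qed

lemma has_derivative_hcosh_grad: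
  assumes "x \<in> hyp_space" "a \<in> hyp_space"
  shows "(hcosh_grad a has_derivative hcosh_hess a x) (at x)"
proof -
  define n m where "n = (x - a) \<bullet> (x - a)" and "m = 1 - x \<bullet> x"
  have nz: "m \<noteq> 0" using assms by (auto simp: hyp_space_iff m_def)
  have A: "((\<lambda>x. 1 / (1 - x \<bullet> x)) has_derivative (\<lambda>v. (0 * m - 1 * (- 2 * (x \<bullet> v))) / (m * m))) (at x)"
    using nz unfolding m_def by (intro has_derivative_divide' has_derivative_const has_derivative_one_minus_inner)
  have M2: "((\<lambda>x. (1 - x \<bullet> x)\<^sup>2) has_derivative (\<lambda>v. - 4 * (x \<bullet> v) * m)) (at x)"
    unfolding m_def
    by (rule has_derivative_eq_rhs [OF has_derivative_power [OF has_derivative_one_minus_inner]])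
       (auto simp: algebra_simps)
  have B: "((\<lambda>x. ((x - a) \<bullet> (x - a)) / (1 - x \<bullet> x)\<^sup>2) has_derivative
      (\<lambda>v. (2 * ((x - a) \<bullet> v) * m\<^sup>2 - n * (- 4 * (x \<bullet> v) * m)) / (m\<^sup>2 * m\<^sup>2))) (at x)"
    using nz M2 unfolding n_def m_def by (intro has_derivative_divide' has_derivative_inner_diff_self) auto
  have B': "(2 * ((x - a) \<bullet> v) * m\<^sup>2 - n * (- 4 * (x \<bullet> v) * m)) / (m\<^sup>2 * m\<^sup>2)
     = 2 * ((x - a) \<bullet> v) / m\<^sup>2 + 4 * n * (x \<bullet> v) / m ^ 3" for v
    using nz by (simp add: field_simps power2_eq_square power3_eq_cube)
  have A': "(0 * m - 1 * (- 2 * (x \<bullet> v))) / (m * m) = 2 * (x \<bullet> v) / m\<^sup>2" for v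
    by (simp add: power2_eq_square)
  show ?thesis
    unfolding hcosh_grad_def [abs_def]
    apply (rule has_derivative_eq_rhs)
     apply (rule has_derivative_scaleR_right has_derivative_add has_derivative_scaleR A [unfolded A'] B [unfolded B']
         has_derivative_ident has_derivative_diff has_derivative_const)+
    by (rule ext) (simp add: hcosh_hess_def m_def n_def algebra_simps)
qed

lemma has_derivative_conf_factor_power:
  assumes "x \<in> hyp_space"
  shows "((\<lambda>y. conf_factor y ^ M) has_derivative
     (\<lambda>v. real M * conf_factor x ^ Suc M * (x \<bullet> v))) (at x)"
proof -
  define m where "m = 1 - x \<bullet> x"
  have nz: "m \<noteq> 0" using assms by (auto simp: hyp_space_iff m_def)
  have "((\<lambda>x. 2 / (1 - x \<bullet> x)) has_derivative (\<lambda>v. (0 * m - 2 * (- 2 * (x \<bullet> v))) / (m * m))) (at x)"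
    using nz unfolding m_def by (intro has_derivative_divide' has_derivative_const has_derivative_one_minus_inner)
  moreover have "(0 * m - 2 * (- 2 * (x \<bullet> v))) / (m * m) = (conf_factor x)\<^sup>2 * (x \<bullet> v)" for v
    unfolding conf_factor_inner by (fold m_def) (simp add: power2_eq_square)
  ultimately have A: "(conf_factor has_derivative (\<lambda>v. (conf_factor x)\<^sup>2 * (x \<bullet> v))) (at x)"
    by (simp add: conf_factor_inner [abs_def])
  show ?thesis
    \<comment> \<open>The power rule leaves the truncated exponent \<open>M - 1\<close>, hence the
      case distinction.\<close>
    by (rule has_derivative_eq_rhs [OF has_derivative_power [OF A]], cases M)
       (auto simp: power2_eq_square algebra_simps)
qed

text \<open>The Euclidean Laplacian of \<open>hcosh a\<close>: multiples of the identity contribute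
  the dimension, and the rank-one parts contribute scalar products by Parseval.\<close>

lemma hcosh_hess_trace:
  fixes x a :: "'a::euclidean_space"
  shows "(\<Sum>b\<in>Basis. hcosh_hess a x b \<bullet> b) = (4 / (1 - a \<bullet> a)) *
     (DIM('a) / (1 - x \<bullet> x) + 4 * (x \<bullet> (x - a)) / (1 - x \<bullet> x)\<^sup>2
      + 4 * ((x - a) \<bullet> (x - a)) * (x \<bullet> x) / (1 - x \<bullet> x) ^ 3
      + DIM('a) * ((x - a) \<bullet> (x - a)) / (1 - x \<bullet> x)\<^sup>2)"
proof -
  define m where "m = 1 - x \<bullet> x"
  define n where "n = (x - a) \<bullet> (x - a)"
  define k where "k = 1 - a \<bullet> a"
  have "hcosh_hess a x b \<bullet> b = (4 / k) *
     ((1 / m + n / m\<^sup>2) * (b \<bullet> b) + (4 / m\<^sup>2) * ((x \<bullet> b) * ((x - a) \<bullet> b))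
      + (4 * n / m ^ 3) * ((x \<bullet> b) * (x \<bullet> b)))" for b
  proof -
    define w y where "w = (x - a) \<bullet> b" and "y = x \<bullet> b"
    show ?thesis
      unfolding hcosh_hess_def inner_add_left inner_scaleR_left
      by (fold m_def k_def n_def w_def y_def) (simp add: ring_distribs)
  qed
  moreover have "(\<Sum>b\<in>(Basis::'a set). b \<bullet> b) = DIM('a)" by simp
  moreover have "(\<Sum>b\<in>Basis. (x \<bullet> b) * (y \<bullet> b)) = x \<bullet> y" for y
    by (rule euclidean_inner [symmetric])
  ultimately have "(\<Sum>b\<in>Basis. hcosh_hess a x b \<bullet> b) = (4 / k) *
     ((1 / m + n / m\<^sup>2) * DIM('a) + (4 / m\<^sup>2) * (x \<bullet> (x - a)) + (4 * n / m ^ 3) * (x \<bullet> x))"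
    by (simp only: sum.distrib sum_distrib_left [symmetric])
  then show ?thesis
    by (fold m_def n_def k_def) (simp add: ring_distribs add_ac)
qed

text \<open>\<open>cosh d\<close> is an eigenfunction of the Laplacian, with eigenvalue \<open>N\<close>.\<close>
lemma divergence_hcosh_grad:
  fixes x a :: "'a::euclidean_space"
  assumes "x \<in> hyp_space" "a \<in> hyp_space" and dim: "DIM('a) = M + 2"
  shows "(\<Sum>b\<in>Basis. real M * conf_factor x ^ Suc M * (x \<bullet> b) * (hcosh_grad a x \<bullet> b)
            + conf_factor x ^ M * (hcosh_hess a x b \<bullet> b))
         = conf_factor x ^ (M + 2) * (real (M + 2) * hcosh a x)"
proof -
  define n m k T where "n = (x - a) \<bullet> (x - a)" and "m = 1 - x \<bullet> x" and "k = 1 - a \<bullet> a"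
    and "T = x \<bullet> (x - a)"
  have nz: "m \<noteq> 0" "k \<noteq> 0" using assms by (auto simp: hyp_space_iff m_def k_def)
  have X: "x \<bullet> x = 1 - m" by (simp add: m_def)
  have T: "T = (n + k - m) / 2" by (simp add: T_def n_def k_def m_def inner_simps inner_commute)
  have "(\<Sum>b\<in>Basis. real M * conf_factor x ^ Suc M * (x \<bullet> b) * (hcosh_grad a x \<bullet> b)
            + conf_factor x ^ M * (hcosh_hess a x b \<bullet> b)) =
     real M * conf_factor x ^ Suc M * (x \<bullet> hcosh_grad a x) + conf_factor x ^ M * (\<Sum>b\<in>Basis. hcosh_hess a x b \<bullet> b)"
    by (simp only: sum.distrib sum_distrib_left [symmetric] mult.assoc euclidean_inner [symmetric])
  also have "\<dots> = conf_factor x ^ M * (real M * conf_factor x * (x \<bullet> hcosh_grad a x) + (\<Sum>b\<in>Basis. hcosh_hess a x b \<bullet> b))"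
    by (simp add: algebra_simps)
  also have "real M * conf_factor x * (x \<bullet> hcosh_grad a x) + (\<Sum>b\<in>Basis. hcosh_hess a x b \<bullet> b)
     = real M * (2 / m) * ((4 / k) * ((1 / m) * T + (n / m\<^sup>2) * (1 - m)))
       + (4 / k) * (real (M + 2) / m + 4 * T / m\<^sup>2 + 4 * n * (1 - m) / m ^ 3 + real (M + 2) * n / m\<^sup>2)"
    unfolding hcosh_hess_trace hcosh_grad_def conf_factor_inner dim inner_scaleR_right inner_add_right
    by (fold n_def k_def T_def m_def) (simp only: X)
  \<comment> \<open>Differentiating the conformal factor gives terms of the same shape as the
    rank-one part of the trace, with \<open>M\<close> in place of 2, so \<open>M + 2\<close> factors
    out before \<open>T\<close> is eliminated.\<close>
  also have "\<dots> = (2 / m)\<^sup>2 * (real (M + 2) * (1 + 2 * n / (m * k)))"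
  proof -
    have "real M * (2 / m) * ((4 / k) * ((1 / m) * T + (n / m\<^sup>2) * (1 - m)))
       + (4 / k) * (real (M + 2) / m + 4 * T / m\<^sup>2 + 4 * n * (1 - m) / m ^ 3 + real (M + 2) * n / m\<^sup>2)
       = real (M + 2) * ((4 / k) * (2 * T / m\<^sup>2 + 2 * n * (1 - m) / m ^ 3 + 1 / m + n / m\<^sup>2))"
      using nz by (simp add: field_simps power2_eq_square power3_eq_cube)
    also have "(4 / k) * (2 * T / m\<^sup>2 + 2 * n * (1 - m) / m ^ 3 + 1 / m + n / m\<^sup>2) = (2 / m)\<^sup>2 * (1 + 2 * n / (m * k))"
      unfolding T using nz by (simp add: field_simps power2_eq_square power3_eq_cube)
    finally show ?thesis by simp
  qed
  also have "\<dots> = (conf_factor x)\<^sup>2 * (real (M + 2) * hcosh a x)"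
    by (simp only: hcosh_def conf_factor_inner n_def m_def k_def)
  finally show ?thesis by (simp only: power_add mult.assoc)
qed

lemma continuous_on_conf_factor: "continuous_on hyp_space conf_factor"
  unfolding conf_factor_inner [abs_def] by (intro continuous_intros) (auto simp: hyp_space_iff)

lemma continuous_on_hcosh: "a \<in> hyp_space \<Longrightarrow> continuous_on hyp_space (hcosh a)"
  by (meson has_derivative_continuous has_derivative_hcosh continuous_at_imp_continuous_on)

lemma continuous_on_hcosh_grad: "a \<in> hyp_space \<Longrightarrow> continuous_on hyp_space (hcosh_grad a)"
  by (meson has_derivative_continuous has_derivative_hcosh_grad continuous_at_imp_continuous_on)

lemma continuous_on_hcosh_hess:
  "a \<in> hyp_space \<Longrightarrow> continuous_on hyp_space (\<lambda>x. hcosh_hess a x b)"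
  unfolding hcosh_hess_def by (intro continuous_intros) (auto simp: hyp_space_iff)

section \<open>Geodesic distance in the Poincare ball\<close>

lemma hnorm_eq: "x \<in> hyp_space \<Longrightarrow> hnorm x v = conf_factor x * norm v"
  using conf_factor_pos [of x]
  by (simp add: hnorm_def hmetric_def real_sqrt_mult norm_eq_sqrt_inner)

text \<open>Cauchy-Schwarz with \<open>|\<nabla> cosh d| = sinh d\<close>: along a curve,
  \<open>cosh d\<close> changes at a rate of at most \<open>sinh d\<close> times the speed. This is
  the differential form of the lower bound for lengths.\<close>

lemma abs_hcosh_grad_inner_le:
  assumes "x \<in> hyp_space" "a \<in> hyp_space"
  shows "\<bar>hcosh_grad a x \<bullet> v\<bar> \<le> sqrt ((hcosh a x)\<^sup>2 - 1) * hnorm x v"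
proof -
  have "norm (hcosh_grad a x) = sqrt ((conf_factor x)\<^sup>2 * ((hcosh a x)\<^sup>2 - 1))"
    by (simp add: norm_eq_sqrt_inner norm_hcosh_grad assms)
  then have "norm (hcosh_grad a x) = conf_factor x * sqrt ((hcosh a x)\<^sup>2 - 1)"
    using conf_factor_pos [OF assms(1)] by (simp add: real_sqrt_mult)
  then show ?thesis
    using Cauchy_Schwarz_ineq2 [of "hcosh_grad a x" v] by (simp add: hnorm_eq assms algebra_simps)
qed

text \<open>Adding \<open>e\<close> keeps the argument of \<open>arcosh\<close> away from 1, where \<open>arcosh\<close> is not differentiable.\<close>
lemma arcosh_hcosh_add_le_curve_length:
  assumes \<gamma>: "\<gamma> C1_differentiable_on {0..1}" "\<gamma> ` {0..1} \<subseteq> hyp_space" and a: "a \<in> hyp_space"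
    and e: "0 < e"
  shows "arcosh (hcosh a (\<gamma> 1) + e) - arcosh (hcosh a (\<gamma> 0) + e) \<le> curve_length \<gamma>"
proof -
  obtain D where D: "\<And>t. t \<in> {0..1} \<Longrightarrow> (\<gamma> has_vector_derivative D t) (at t)"
    and contD: "continuous_on {0..1} D"
    using \<gamma>(1) unfolding C1_differentiable_on_def by blast
  have inh: "\<gamma> t \<in> hyp_space" if "t \<in> {0..1}" for t using \<gamma>(2) that by auto
  have cont\<gamma>: "continuous_on {0..1} \<gamma>"
    using D by (meson continuous_at_imp_continuous_on has_vector_derivative_continuous)
  define \<sigma> where "\<sigma> t = hcosh a (\<gamma> t) + e" for t
  have \<sigma>1: "1 < \<sigma> t" and \<sigma>h: "hcosh a (\<gamma> t) \<le> \<sigma> t" "1 \<le> hcosh a (\<gamma> t)" if "t \<in> {0..1}" for t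
    using hcosh_ge_1 [OF inh [OF that] a] e by (auto simp: \<sigma>_def)
  define q where "q t = (hcosh_grad a (\<gamma> t) \<bullet> D t) / sqrt ((\<sigma> t)\<^sup>2 - 1)" for t
  have deriv: "((\<lambda>t. arcosh (\<sigma> t)) has_vector_derivative q t) (at t within {0..1})" if t: "t \<in> {0..1}" for t
  proof -
    have "((hcosh a \<circ> \<gamma>) has_derivative (\<lambda>v. hcosh_grad a (\<gamma> t) \<bullet> v) \<circ> (\<lambda>x. x *\<^sub>R D t)) (at t)"
      using D [OF t] by (intro diff_chain_at has_derivative_hcosh inh t a) (simp add: has_vector_derivative_def)
    then have "((\<lambda>t. hcosh a (\<gamma> t)) has_real_derivative (hcosh_grad a (\<gamma> t) \<bullet> D t)) (at t)"
      by (simp add: has_field_derivative_def o_def mult_commute_abs)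
    then have "(\<sigma> has_real_derivative (hcosh_grad a (\<gamma> t) \<bullet> D t)) (at t)"
      unfolding \<sigma>_def [abs_def] by (auto intro!: derivative_eq_intros)
    then have "((\<lambda>t. arcosh (\<sigma> t)) has_real_derivative q t) (at t)"
      using DERIV_chain2 [where g = \<sigma>, OF arcosh_real_has_field_derivative [OF \<sigma>1 [OF t], of UNIV]]
      by (fastforce simp: q_def)
    then show ?thesis
      by (simp add: has_real_derivative_iff_has_vector_derivative has_vector_derivative_at_within)
  qed
  have "(q has_integral (arcosh (\<sigma> 1) - arcosh (\<sigma> 0))) {0..1}"
    by (rule fundamental_theorem_of_calculus) (auto intro: deriv)
  moreover have "((\<lambda>t. hnorm (\<gamma> t) (D t)) has_integral curve_length \<gamma>) {0..1}"
  proof -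
    have "(\<lambda>t. hnorm (\<gamma> t) (D t)) integrable_on {0..1}"
    proof (rule integrable_continuous_real)
      have "continuous_on {0..1} (\<lambda>t. conf_factor (\<gamma> t) * norm (D t))"
        by (intro continuous_intros contD continuous_on_compose2 [OF continuous_on_conf_factor cont\<gamma>] \<gamma>(2))
      then show "continuous_on {0..1} (\<lambda>t. hnorm (\<gamma> t) (D t))"
        by (rule continuous_on_eq) (simp add: hnorm_eq inh)
    qed
    moreover have "integral {0..1} (\<lambda>t. hnorm (\<gamma> t) (D t)) = curve_length \<gamma>"
      unfolding curve_length_def
      by (rule integral_cong) (simp add: vector_derivative_at [OF D])
    ultimately show ?thesis by (simp add: has_integral_iff)
  qed
  moreover have "q t \<le> hnorm (\<gamma> t) (D t)" if t: "t \<in> {0..1}" for t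
  proof -
    have pos: "0 < sqrt ((\<sigma> t)\<^sup>2 - 1)" using \<sigma>1 [OF t] by (simp add: power2_eq_square less_1_mult)
    have "hcosh_grad a (\<gamma> t) \<bullet> D t \<le> sqrt ((hcosh a (\<gamma> t))\<^sup>2 - 1) * hnorm (\<gamma> t) (D t)"
      using abs_hcosh_grad_inner_le [OF inh [OF t] a, of "D t"] by linarith
    \<comment> \<open>The shift by \<open>e\<close> only enlarges the root, so the quotient
      \<open>q t\<close> is still at most the speed.\<close>
    also have "\<dots> \<le> sqrt ((\<sigma> t)\<^sup>2 - 1) * hnorm (\<gamma> t) (D t)"
      using \<sigma>h [OF t] conf_factor_pos [OF inh [OF t]]
      by (intro mult_right_mono) (auto simp: hnorm_eq [OF inh [OF t]] intro!: power_mono)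
    finally show ?thesis using pos by (simp add: q_def divide_le_eq mult.commute)
  qed
  ultimately have "arcosh (\<sigma> 1) - arcosh (\<sigma> 0) \<le> curve_length \<gamma>"
    by (rule has_integral_le)
  then show ?thesis by (simp add: \<sigma>_def)
qed

text \<open>The limit of the shifted bound as \<open>e\<close> tends to 0 from the right, by
  continuity of \<open>arcosh\<close> on \<open>{1..}\<close>. The starting point contributes
  \<open>arcosh 1 = 0\<close>.\<close>

lemma arcosh_hcosh_le_curve_length:
  assumes \<gamma>: "\<gamma> C1_differentiable_on {0..1}" "\<gamma> ` {0..1} \<subseteq> hyp_space" and a: "a \<in> hyp_space"
    and ends: "\<gamma> 0 = a" "\<gamma> 1 = x"
  shows "arcosh (hcosh a x) \<le> curve_length \<gamma>"
proof -
  have x: "x \<in> hyp_space" using \<gamma>(2) ends by auto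
  have F: "1 \<le> hcosh a x" by (rule hcosh_ge_1 [OF x a])
  have A: "((\<lambda>e. arcosh (hcosh a x + e) - arcosh (1 + e)) \<longlongrightarrow> arcosh (hcosh a x + 0) - arcosh (1 + 0)) (at_right 0)"
    by (intro tendsto_diff tendsto_arcosh_strong tendsto_intros)
       (use F in \<open>auto simp: eventually_at intro!: exI [of _ 1]\<close>)
  have "arcosh (hcosh a x + 0) - arcosh (1 + 0) \<le> curve_length \<gamma>"
  proof (rule tendsto_upperbound [OF A])
    show "\<forall>\<^sub>F e in at_right 0. arcosh (hcosh a x + e) - arcosh (1 + e) \<le> curve_length \<gamma>"
      using arcosh_hcosh_add_le_curve_length [OF \<gamma> a]
      by (auto simp: eventually_at ends hcosh_self intro!: exI [of _ 1])
  qed simp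
  then show ?thesis by simp
qed

text \<open>In hyperboloid coordinates \<open>(X\<^sub>0, X\<^sub>v)\<close>, \<open>X\<^sub>0\<^sup>2 - |X\<^sub>v|\<^sup>2 = 1\<close>, the Poincare ball is
  \<open>X\<^sub>v / (1 + X\<^sub>0)\<close> and the hyperbolic norm of a velocity is its Lorentz norm.\<close>
lemma stereographic_in_hyp_space:
  fixes v :: "'a::euclidean_space" and c :: real
  assumes "c\<^sup>2 - v \<bullet> v = 1" "0 < c"
  shows "(1 / (1 + c)) *\<^sub>R v \<in> hyp_space" "conf_factor ((1 / (1 + c)) *\<^sub>R v) = 1 + c"
proof -
  have vv: "v \<bullet> v = (c - 1) * (c + 1)" using assms by (simp add: algebra_simps power2_eq_square)
  have eq: "((1 / (1 + c)) *\<^sub>R v) \<bullet> ((1 / (1 + c)) *\<^sub>R v) = (c - 1) / (c + 1)"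
    using assms(2) by (simp add: vv add.commute [of c 1])
  show "(1 / (1 + c)) *\<^sub>R v \<in> hyp_space"
    using assms(2) unfolding hyp_space_iff eq by simp
  show "conf_factor ((1 / (1 + c)) *\<^sub>R v) = 1 + c"
    using assms(2) unfolding conf_factor_inner eq by (simp add: divide_simps)
qed

lemma has_vector_derivative_stereographic:
  fixes v :: "real \<Rightarrow> 'a::euclidean_space" and c :: "real \<Rightarrow> real"
  assumes v: "(v has_vector_derivative v') (at t)" and c: "(c has_real_derivative c') (at t)" and "0 < c t"
  shows "((\<lambda>t. (1 / (1 + c t)) *\<^sub>R v t) has_vector_derivative
     (1 / (1 + c t)) *\<^sub>R v' - (c' / (1 + c t)\<^sup>2) *\<^sub>R v t) (at t)"
proof -
  have "((\<lambda>t. 1 / (1 + c t)) has_real_derivative - c' / (1 + c t)\<^sup>2) (at t)"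
    using assms(3) by (auto intro!: derivative_eq_intros c simp: power2_eq_square)
  from has_vector_derivative_scaleR [OF this v]
  show ?thesis by (simp add: algebra_simps)
qed

text \<open>In the Euclidean square of the projected velocity, tangency and
  \<open>v . v = c^2 - 1\<close> cancel all terms in \<open>c'\<close>. The Euclidean norm is then
  \<open>l / (1 + c)\<close>, and the conformal factor \<open>1 + c\<close> removes the
  denominator.\<close>

lemma hnorm_stereographic:
  fixes v v' :: "'a::euclidean_space" and c c' :: real
  assumes "c\<^sup>2 - v \<bullet> v = 1" "0 < c" and tangent: "c * c' = v \<bullet> v'" and len: "v' \<bullet> v' - c'\<^sup>2 = l\<^sup>2" "0 \<le> l"
  shows "hnorm ((1 / (1 + c)) *\<^sub>R v) ((1 / (1 + c)) *\<^sub>R v' - (c' / (1 + c)\<^sup>2) *\<^sub>R v) = l"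
proof -
  have vv: "v \<bullet> v = c\<^sup>2 - 1" using assms by simp
  have vv': "v' \<bullet> v' = l\<^sup>2 + c'\<^sup>2" using len by simp
  have "((1 / (1 + c)) *\<^sub>R v' - (c' / (1 + c)\<^sup>2) *\<^sub>R v) \<bullet> ((1 / (1 + c)) *\<^sub>R v' - (c' / (1 + c)\<^sup>2) *\<^sub>R v)
     = (v' \<bullet> v') / (1 + c)\<^sup>2 - 2 * c' * (v \<bullet> v') / (1 + c) ^ 3 + c'\<^sup>2 * (v \<bullet> v) / (1 + c) ^ 4"
    using assms(2) by (simp add: inner_diff_left inner_diff_right inner_commute [of v' v] diff_divide_distrib right_diff_distrib power2_eq_square power3_eq_cube power4_eq_xxxx mult_ac)
  also have "\<dots> = l\<^sup>2 / (1 + c)\<^sup>2"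
  proof -
    have nz: "1 + c \<noteq> 0" using assms(2) by simp
    then have f1: "c'\<^sup>2 * (v \<bullet> v) / (1 + c) ^ 4 = c'\<^sup>2 * (c - 1) / (1 + c) ^ 3"
      unfolding vv by (simp add: divide_simps) algebra
    have f2: "2 * c' * (v \<bullet> v') / (1 + c) ^ 3 = 2 * c'\<^sup>2 * c / (1 + c) ^ 3"
      unfolding tangent [symmetric] by (simp add: power2_eq_square)
    \<comment> \<open>The cancellation: \<open>(1 + c) - 2 c + (c - 1) = 0\<close>.\<close>
    have f3: "c'\<^sup>2 / (1 + c)\<^sup>2 - 2 * c'\<^sup>2 * c / (1 + c) ^ 3 + c'\<^sup>2 * (c - 1) / (1 + c) ^ 3 = 0"
      using nz by (simp add: divide_simps) algebra
    show ?thesis unfolding f1 f2 vv' add_divide_distrib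
      using f3 by (metis (no_types, opaque_lifting) add.assoc add.right_neutral add_diff_eq)
  qed
  finally have "norm ((1 / (1 + c)) *\<^sub>R v' - (c' / (1 + c)\<^sup>2) *\<^sub>R v) = l / (1 + c)"
    using assms by (simp add: norm_eq_sqrt_inner real_sqrt_divide)
  then show ?thesis
    using stereographic_in_hyp_space [OF assms(1,2)] assms(2) by (simp add: hnorm_eq)
qed

text \<open>Inverse stereographic projection: the lift of a ball point to the upper sheet, with time
  coordinate \<open>c = hcosh 0 a\<close>.\<close>

lemma hyperboloid_point:
  assumes "a \<in> hyp_space"
  defines "c \<equiv> (1 + a \<bullet> a) / (1 - a \<bullet> a)" and "v \<equiv> (2 / (1 - a \<bullet> a)) *\<^sub>R a"
  shows "c\<^sup>2 - v \<bullet> v = 1" "1 \<le> c" "(1 / (1 + c)) *\<^sub>R v = a"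
proof -
  define k where "k = 1 - a \<bullet> a"
  have k: "0 < k" using assms by (simp add: hyp_space_iff k_def)
  have aa: "a \<bullet> a = 1 - k" by (simp add: k_def)
  have c: "c = (2 - k) / k" and v: "v = (2 / k) *\<^sub>R a" by (simp_all add: c_def v_def aa)
  show "c\<^sup>2 - v \<bullet> v = 1" using k by (simp add: c v aa power2_eq_square field_simps)
  show "1 \<le> c" using k aa inner_ge_zero [of a] by (simp add: c)
  have "1 + c = 2 / k" using k by (simp add: c field_simps)
  then show "(1 / (1 + c)) *\<^sub>R v = a" using k by (simp add: v)
qed

text \<open>The right-hand side is the Lorentz product of the two lifts. It links the rational
  formula in the ball to the hyperboloid, where geodesics come from linear algebra.\<close>

lemma hcosh_lorentz:
  assumes "a \<in> hyp_space" "x \<in> hyp_space"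
  shows "hcosh a x = ((1 + a \<bullet> a) / (1 - a \<bullet> a)) * ((1 + x \<bullet> x) / (1 - x \<bullet> x))
     - ((2 / (1 - a \<bullet> a)) *\<^sub>R a) \<bullet> ((2 / (1 - x \<bullet> x)) *\<^sub>R x)"
proof -
  define m k q where "m = 1 - x \<bullet> x" and "k = 1 - a \<bullet> a" and "q = a \<bullet> x"
  have nz: "m \<noteq> 0" "k \<noteq> 0" using assms by (auto simp: hyp_space_iff m_def k_def)
  have e: "x \<bullet> x = 1 - m" "a \<bullet> a = 1 - k" "(x - a) \<bullet> (x - a) = 2 - m - k - 2 * q"
    by (simp_all add: m_def k_def q_def inner_simps inner_commute)
  show ?thesis
    unfolding hcosh_def e inner_scaleR_left inner_scaleR_right
    using nz by (fold q_def) (simp add: field_simps)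
qed

text \<open>Hyperbolic analogue of spherical linear interpolation: between the lifts
  \<open>X1\<close> and \<open>X2\<close> take \<open>(sinh ((1 - t) \<rho>) X1 + sinh (t \<rho>)
  X2) / sinh \<rho>\<close>, which stays on the hyperboloid and moves with constant speed
  \<open>\<rho>\<close>. Dividing by \<open>sinh \<rho>\<close> requires distinct endpoints.\<close>

lemma geodesic_segment_exists:
  assumes a: "a \<in> hyp_space" and x: "x \<in> hyp_space" and neq: "x \<noteq> a"
  shows "\<exists>\<gamma>. \<gamma> C1_differentiable_on {0..1} \<and> \<gamma> ` {0..1} \<subseteq> hyp_space \<and> \<gamma> 0 = a \<and> \<gamma> 1 = x
     \<and> curve_length \<gamma> = arcosh (hcosh a x)"
proof -
  define \<rho> where "\<rho> = arcosh (hcosh a x)"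
  have C: "cosh \<rho> = hcosh a x" and \<rho>: "0 < \<rho>"
    using hcosh_gt_1 [OF x a neq] by (simp_all add: \<rho>_def)
  then have S: "0 < sinh \<rho>" by simp
  define c1 v1 c2 v2 where "c1 = (1 + a \<bullet> a) / (1 - a \<bullet> a)" and "v1 = (2 / (1 - a \<bullet> a)) *\<^sub>R a"
    and "c2 = (1 + x \<bullet> x) / (1 - x \<bullet> x)" and "v2 = (2 / (1 - x \<bullet> x)) *\<^sub>R x"
  have h1: "v1 \<bullet> v1 = c1\<^sup>2 - 1" "1 \<le> c1" "(1 / (1 + c1)) *\<^sub>R v1 = a"
    using hyperboloid_point [OF a] by (auto simp: c1_def v1_def)
  have h2: "v2 \<bullet> v2 = c2\<^sup>2 - 1" "1 \<le> c2" "(1 / (1 + c2)) *\<^sub>R v2 = x"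
    using hyperboloid_point [OF x] by (auto simp: c2_def v2_def)
  have h12: "v1 \<bullet> v2 = c1 * c2 - cosh \<rho>" "v2 \<bullet> v1 = c1 * c2 - cosh \<rho>"
    using hcosh_lorentz [OF a x] by (auto simp: c1_def v1_def c2_def v2_def C inner_commute)
  define \<alpha> \<beta> \<alpha>' \<beta>' where "\<alpha> t = sinh ((1 - t) * \<rho>) / sinh \<rho>" and "\<beta> t = sinh (t * \<rho>) / sinh \<rho>"
    and "\<alpha>' t = - \<rho> * cosh ((1 - t) * \<rho>) / sinh \<rho>" and "\<beta>' t = \<rho> * cosh (t * \<rho>) / sinh \<rho>" for t
  define c where "c t = \<alpha> t * c1 + \<beta> t * c2" for t
  define c' where "c' t = \<alpha>' t * c1 + \<beta>' t * c2" for t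
  define v where "v t = \<alpha> t *\<^sub>R v1 + \<beta> t *\<^sub>R v2" for t
  define v' where "v' t = \<alpha>' t *\<^sub>R v1 + \<beta>' t *\<^sub>R v2" for t
  have d\<alpha>: "(\<alpha> has_real_derivative \<alpha>' t) (at t)" and d\<beta>: "(\<beta> has_real_derivative \<beta>' t) (at t)" for t
    unfolding \<alpha>_def [abs_def] \<beta>_def [abs_def] \<alpha>'_def \<beta>'_def
    using S by (auto intro!: derivative_eq_intros simp: field_simps)
  have dc: "(c has_real_derivative c' t) (at t)" for t
    unfolding c_def [abs_def] c'_def by (intro DERIV_add DERIV_cmult_right d\<alpha> d\<beta>)
  have dv: "(v has_vector_derivative v' t) (at t)" for t
    unfolding v_def [abs_def] v'_def
    by (rule has_vector_derivative_eq_rhs, (rule has_vector_derivative_add has_vector_derivative_scaleR d\<alpha> d\<beta> has_vector_derivative_const)+) simp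
  \<comment> \<open>The Lorentz Gram matrix of the two lifts has diagonal 1 and off-diagonal
    \<open>cosh \<rho>\<close>. So these identities say that the interpolated point has square 1,
    that its velocity has square \<open>- \<rho>\<^sup>2\<close>, and that the two are
    orthogonal.\<close>
  have rels: "(\<alpha> t)\<^sup>2 + (\<beta> t)\<^sup>2 + 2 * \<alpha> t * \<beta> t * cosh \<rho> = 1"
    "(\<alpha>' t)\<^sup>2 + (\<beta>' t)\<^sup>2 + 2 * \<alpha>' t * \<beta>' t * cosh \<rho> = - \<rho>\<^sup>2"
    "\<alpha> t * \<alpha>' t + \<beta> t * \<beta>' t + (\<alpha> t * \<beta>' t + \<beta> t * \<alpha>' t) * cosh \<rho> = 0" for t
  proof -
    define A B where "A = (1 - t) * \<rho>" and "B = t * \<rho>"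
    have AB: "\<rho> = A + B" by (simp add: A_def B_def algebra_simps)
    define sA cA sB cB where "sA = sinh A" "cA = cosh A" "sB = sinh B" "cB = cosh B"
    note defs = this
    have ids: "cA\<^sup>2 = sA\<^sup>2 + 1" "cB\<^sup>2 = sB\<^sup>2 + 1" by (simp_all add: defs cosh_square_eq)
    have sr: "sinh \<rho> = sA * cB + cA * sB" and cr: "cosh \<rho> = cA * cB + sA * sB"
      by (simp_all add: AB defs sinh_add cosh_add)
    have nz: "sA * cB + cA * sB \<noteq> 0" using S sr by simp
    have e: "\<alpha> t = sA / sinh \<rho>" "\<beta> t = sB / sinh \<rho>" "\<alpha>' t = - \<rho> * cA / sinh \<rho>" "\<beta>' t = \<rho> * cB / sinh \<rho>"
      by (simp_all add: \<alpha>_def \<beta>_def \<alpha>'_def \<beta>'_def defs A_def B_def)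
    have "sA\<^sup>2 + sB\<^sup>2 + 2 * sA * sB * cosh \<rho> = (sinh \<rho>)\<^sup>2"
      unfolding sr cr using ids by algebra
    then have "(sA\<^sup>2 + sB\<^sup>2 + 2 * sA * sB * cosh \<rho>) / (sinh \<rho>)\<^sup>2 = 1"
      using S by simp
    then show "(\<alpha> t)\<^sup>2 + (\<beta> t)\<^sup>2 + 2 * \<alpha> t * \<beta> t * cosh \<rho> = 1"
      unfolding e by (simp add: power2_eq_square add_divide_distrib mult_ac)
    have "cA\<^sup>2 + cB\<^sup>2 - 2 * cA * cB * cosh \<rho> = - (sinh \<rho>)\<^sup>2"
      unfolding sr cr using ids by algebra
    then have "\<rho>\<^sup>2 * (cA\<^sup>2 + cB\<^sup>2 - 2 * cA * cB * cosh \<rho>) / (sinh \<rho>)\<^sup>2 = - \<rho>\<^sup>2"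
      using S by simp
    then show "(\<alpha>' t)\<^sup>2 + (\<beta>' t)\<^sup>2 + 2 * \<alpha>' t * \<beta>' t * cosh \<rho> = - \<rho>\<^sup>2"
      unfolding e by (simp add: power2_eq_square ring_distribs add_divide_distrib diff_divide_distrib mult_ac)
    have "- sA * cA + sB * cB + (sA * cB - sB * cA) * cosh \<rho> = 0"
      unfolding cr using ids by algebra
    then have "\<rho> * (- sA * cA + sB * cB + (sA * cB - sB * cA) * cosh \<rho>) / (sinh \<rho>)\<^sup>2 = 0" by simp
    then show "\<alpha> t * \<alpha>' t + \<beta> t * \<beta>' t + (\<alpha> t * \<beta>' t + \<beta> t * \<alpha>' t) * cosh \<rho> = 0"
      unfolding e by (simp add: power2_eq_square ring_distribs add_divide_distrib diff_divide_distrib mult_ac)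
  qed
  \<comment> \<open>A positive time coordinate selects the upper sheet, which projects into the
    ball.\<close>
  have cpos: "0 < c t" if "t \<in> {0..1}" for t
  proof -
    have "0 \<le> \<alpha> t" "0 \<le> \<beta> t" using that \<rho> by (auto simp: \<alpha>_def \<beta>_def)
    moreover have "0 < \<alpha> t \<or> 0 < \<beta> t"
      using that \<rho> by (cases "t = 0") (auto simp: \<alpha>_def \<beta>_def zero_less_mult_iff)
    ultimately have "0 \<le> \<alpha> t * c1" "0 \<le> \<beta> t * c2" "0 < \<alpha> t * c1 \<or> 0 < \<beta> t * c2"
      using h1(2) h2(2) by auto
    then show ?thesis unfolding c_def by linarith
  qed
  have unit: "(c t)\<^sup>2 - v t \<bullet> v t = 1" for t
    unfolding c_def v_def inner_add_left inner_add_right inner_scaleR_left inner_scaleR_right h1(1) h2(1) h12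
    using rels(1) [of t] by algebra
  have tangent: "c t * c' t = v t \<bullet> v' t" for t
    unfolding c_def v_def c'_def v'_def inner_add_left inner_add_right inner_scaleR_left inner_scaleR_right h1(1) h2(1) h12
    using rels(3) [of t] by algebra
  have speed: "v' t \<bullet> v' t - (c' t)\<^sup>2 = \<rho>\<^sup>2" for t
    unfolding c'_def v'_def inner_add_left inner_add_right inner_scaleR_left inner_scaleR_right h1(1) h2(1) h12
    using rels(2) [of t] by algebra
  define \<gamma> where "\<gamma> t = (1 / (1 + c t)) *\<^sub>R v t" for t
  define D where "D t = (1 / (1 + c t)) *\<^sub>R v' t - (c' t / (1 + c t)\<^sup>2) *\<^sub>R v t" for t
  have D: "(\<gamma> has_vector_derivative D t) (at t)" if "t \<in> {0..1}" for t
    unfolding \<gamma>_def [abs_def] D_def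
    by (rule has_vector_derivative_stereographic [OF dv dc cpos [OF that]])
  have "continuous_on {0..1} c" "continuous_on {0..1} v"
    using dc dv by (meson DERIV_isCont continuous_at_imp_continuous_on has_vector_derivative_continuous)+
  moreover have "continuous_on {0..1} c'" "continuous_on {0..1} v'"
    unfolding c'_def [abs_def] v'_def [abs_def] \<alpha>'_def \<beta>'_def using S by (auto intro!: continuous_intros)
  ultimately have "continuous_on {0..1} D"
    unfolding D_def [abs_def] using cpos by (auto intro!: continuous_intros) (use cpos in force)+
  then have "\<gamma> C1_differentiable_on {0..1}"
    unfolding C1_differentiable_on_def using D by blast
  moreover have "\<gamma> ` {0..1} \<subseteq> hyp_space"
    using stereographic_in_hyp_space(1) [OF unit cpos] by (auto simp: \<gamma>_def)
  moreover have "\<gamma> 0 = a" "\<gamma> 1 = x"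
    using S h1(3) h2(3) by (auto simp: \<gamma>_def c_def v_def \<alpha>_def \<beta>_def)
  moreover have "curve_length \<gamma> = \<rho>"
  proof -
    have "hnorm (\<gamma> t) (vector_derivative \<gamma> (at t)) = \<rho>" if "t \<in> {0..1}" for t
      unfolding vector_derivative_at [OF D [OF that]] unfolding \<gamma>_def D_def
      using \<rho> by (intro hnorm_stereographic unit cpos [OF that] tangent speed) auto
    note speed_eq = this
    have "curve_length \<gamma> = integral {0..1::real} (\<lambda>t. \<rho>)"
      unfolding curve_length_def by (rule integral_cong) (rule speed_eq)
    then show ?thesis by simp
  qed
  ultimately show ?thesis by (auto simp: \<rho>_def)
qed

lemma hdist_eq:
  assumes a: "a \<in> hyp_space" and x: "x \<in> hyp_space"
  shows "hdist a x = arcosh (hcosh a x)"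
proof -
  let ?S = "{curve_length \<gamma> |\<gamma>. \<gamma> C1_differentiable_on {0..1} \<and>
     \<gamma> ` {0..1} \<subseteq> hyp_space \<and> \<gamma> 0 = a \<and> \<gamma> 1 = x}"
  have "arcosh (hcosh a x) \<in> ?S"
  proof (cases "x = a")
    \<comment> \<open>The interpolation degenerates for equal endpoints; the constant curve replaces
      it.\<close>
    case True
    have "(\<lambda>t::real. a) C1_differentiable_on {0..1}" "curve_length (\<lambda>t. a) = 0"
      using a by (simp_all add: curve_length_def hnorm_eq)
    then show ?thesis using True a by (auto simp: hcosh_self image_subset_iff intro!: exI [of _ "\<lambda>t. a"])
  next
    case False
    show ?thesis
      using geodesic_segment_exists [OF a x False] unfolding mem_Collect_eq by metis
  qed
  moreover have "arcosh (hcosh a x) \<le> l" if "l \<in> ?S" for l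
    using that arcosh_hcosh_le_curve_length [OF _ _ a] by auto
  ultimately show ?thesis unfolding hdist_def by (intro cInf_eq_minimum)
qed

section \<open>Radial functions and fields\<close>

lemma cosh_hdist: "a \<in> hyp_space \<Longrightarrow> x \<in> hyp_space \<Longrightarrow> cosh (hdist a x) = hcosh a x"
  by (simp add: hdist_eq hcosh_ge_1)

lemma sinh_hdist: "a \<in> hyp_space \<Longrightarrow> x \<in> hyp_space \<Longrightarrow> sinh (hdist a x) = sqrt ((hcosh a x)\<^sup>2 - 1)"
  by (simp add: hdist_eq hcosh_ge_1 sinh_arcosh_real)

lemma hdist_pos: "a \<in> hyp_space \<Longrightarrow> x \<in> hyp_space \<Longrightarrow> x \<noteq> a \<Longrightarrow> 0 < hdist a x"
  using hcosh_gt_1 [of x a] by (simp add: hdist_eq)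

lemma hdist_self: "a \<in> hyp_space \<Longrightarrow> hdist a a = 0"
  by (simp add: hdist_eq hcosh_self)

lemma continuous_on_hdist:
  assumes "a \<in> hyp_space"
  shows "continuous_on hyp_space (hdist a)"
proof -
  have "continuous_on hyp_space (\<lambda>x. arcosh (hcosh a x))"
    using assms
    by (intro continuous_on_compose2 [OF continuous_on_arcosh [of "{1..}"] continuous_on_hcosh])
       (auto simp: hcosh_ge_1)
  then show ?thesis by (rule continuous_on_eq) (simp add: hdist_eq assms)
qed

lemma has_derivative_hdist:
  assumes a: "a \<in> hyp_space" and x: "x \<in> hyp_space" and "x \<noteq> a"
  shows "(hdist a has_derivative (\<lambda>v. (hcosh_grad a x \<bullet> v) / sinh (hdist a x))) (at x)"
proof -
  have "1 < hcosh a x" by (rule hcosh_gt_1) (use assms in auto)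
  then have "(arcosh has_real_derivative (1 / sinh (hdist a x))) (at (hcosh a x))"
    by (auto intro!: derivative_eq_intros simp: sinh_hdist a x)
  then have "(arcosh has_derivative (\<lambda>h. h * (1 / sinh (hdist a x)))) (at (hcosh a x))"
    unfolding has_field_derivative_def by (rule has_derivative_eq_rhs) auto
  from has_derivative_compose [OF has_derivative_hcosh [OF x a] this]
  have "((\<lambda>y. arcosh (hcosh a y)) has_derivative (\<lambda>v. (hcosh_grad a x \<bullet> v) / sinh (hdist a x))) (at x)"
    by simp
  then show ?thesis
    by (rule has_derivative_transform_within_open [OF _ open_hyp_space x]) (simp add: hdist_eq a)
qed

lemma has_derivative_radial:
  assumes a: "a \<in> hyp_space" and x: "x \<in> hyp_space" and "x \<noteq> a"
    and h: "(h has_real_derivative h') (at (hdist a x))"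
  shows "((\<lambda>y. h (hdist a y)) has_derivative (\<lambda>v. h' / sinh (hdist a x) * (hcosh_grad a x \<bullet> v))) (at x)"
  using has_derivative_compose [OF has_derivative_hdist [OF assms(1-3)] h [unfolded has_field_derivative_def]]
  by simp

lemma partial_deriv_eqI: "(u has_derivative D) (at x) \<Longrightarrow> partial_deriv b u x = D b"
  unfolding partial_deriv_def by (metis frechet_derivative_at)

lemma hgrad_eq:
  assumes "(u has_derivative (\<lambda>v. g \<bullet> v)) (at x)"
  shows "hgrad u x = (1 / (conf_factor x)\<^sup>2) *\<^sub>R g"
proof -
  have "hgrad u x = (\<Sum>b\<in>Basis. (1 / (conf_factor x)\<^sup>2) *\<^sub>R ((g \<bullet> b) *\<^sub>R b))"
    unfolding hgrad_def by (simp add: partial_deriv_eqI [OF assms])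
  then show ?thesis by (simp only: scaleR_sum_right [symmetric] euclidean_representation)
qed

text \<open>The chain rule through \<open>arcosh\<close> divides by \<open>sinh d\<close>, which
  \<open>|\<nabla> cosh d| = sinh d\<close> cancels.\<close>

lemma hnorm_hgrad_radial:
  assumes a: "a \<in> hyp_space" and x: "x \<in> hyp_space" and neq: "x \<noteq> a"
    and h: "(h has_real_derivative h') (at (hdist a x))"
  shows "(hnorm x (hgrad (\<lambda>y. h (hdist a y)) x))\<^sup>2 = h'\<^sup>2"
proof -
  define c where "c = conf_factor x"
  define s where "s = sinh (hdist a x)"
  have c: "0 < c" by (simp add: c_def conf_factor_pos x)
  have s: "0 < s" using hdist_pos [OF a x neq] by (simp add: s_def)
  have s2: "s\<^sup>2 = (hcosh a x)\<^sup>2 - 1"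
    by (simp add: s_def sinh_square_eq cosh_hdist a x)
  have "hgrad (\<lambda>y. h (hdist a y)) x = (1 / c\<^sup>2) *\<^sub>R ((h' / s) *\<^sub>R hcosh_grad a x)"
    unfolding c_def s_def by (rule hgrad_eq) (use has_derivative_radial [OF a x neq h] in simp)
  then have "(hnorm x (hgrad (\<lambda>y. h (hdist a y)) x))\<^sup>2 = (c * (1 / c\<^sup>2) * (h' / s))\<^sup>2 * (hcosh_grad a x \<bullet> hcosh_grad a x)"
    by (simp add: hnorm_eq x power_mult_distrib power2_norm_eq_inner power2_abs c_def power_divide)
  also have "\<dots> = (c * (1 / c\<^sup>2) * (h' / s))\<^sup>2 * (c\<^sup>2 * s\<^sup>2)"
    by (simp add: norm_hcosh_grad a x s2 c_def)
  also have "\<dots> = h'\<^sup>2" using c s by (simp add: power2_eq_square)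
  finally show ?thesis .
qed

text \<open>Component \<open>b\<close> of \<open>sqrt (det g)\<close> times the field
  \<open>h(d) \<nabla> cosh d\<close>. The density contributes \<open>\<lambda>^N\<close> and the
  inverse metric \<open>\<lambda>^(-2)\<close>, so \<open>M\<close> stands for \<open>N - 2\<close>.
  Using \<open>cosh d\<close> instead of \<open>d\<close> keeps the vector part rational.\<close>

definition radial_field :: "'a::euclidean_space \<Rightarrow> (real \<Rightarrow> real) \<Rightarrow> nat \<Rightarrow> 'a \<Rightarrow> 'a \<Rightarrow> real" where
  "radial_field a h M b y = h (hdist a y) * (conf_factor y ^ M * (hcosh_grad a y \<bullet> b))"

definition radial_field_deriv ::
  "'a::euclidean_space \<Rightarrow> (real \<Rightarrow> real) \<Rightarrow> (real \<Rightarrow> real) \<Rightarrow> nat \<Rightarrow> 'a \<Rightarrow> 'a \<Rightarrow> 'a \<Rightarrow> real" where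
  "radial_field_deriv a h h' M b x v =
     h' (hdist a x) / sinh (hdist a x) * (hcosh_grad a x \<bullet> v) * (conf_factor x ^ M * (hcosh_grad a x \<bullet> b))
     + h (hdist a x) * (real M * conf_factor x ^ Suc M * (x \<bullet> v) * (hcosh_grad a x \<bullet> b)
         + conf_factor x ^ M * (hcosh_hess a x v \<bullet> b))"

lemma has_derivative_radial_field:
  assumes a: "a \<in> hyp_space" and x: "x \<in> hyp_space" and neq: "x \<noteq> a"
    and h: "(h has_real_derivative h' (hdist a x)) (at (hdist a x))"
  shows "(radial_field a h M b has_derivative radial_field_deriv a h h' M b x) (at x)"
proof -
  have "((\<lambda>y. h (hdist a y) * (conf_factor y ^ M * (hcosh_grad a y \<bullet> b))) has_derivative
     (\<lambda>v. h (hdist a x) * (conf_factor x ^ M * (hcosh_hess a x v \<bullet> b)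
         + (real M * conf_factor x ^ Suc M * (x \<bullet> v)) * (hcosh_grad a x \<bullet> b))
      + h' (hdist a x) / sinh (hdist a x) * (hcosh_grad a x \<bullet> v) * (conf_factor x ^ M * (hcosh_grad a x \<bullet> b)))) (at x)"
    by (intro has_derivative_mult has_derivative_radial [OF a x neq h] has_derivative_conf_factor_power x
        has_derivative_inner_left has_derivative_hcosh_grad a)
  then show ?thesis
    unfolding radial_field_def [abs_def] by (rule has_derivative_eq_rhs) (simp add: radial_field_deriv_def [abs_def] add_ac)
qed

text \<open>The derivative of \<open>h\<close> meets \<open>|\<nabla> cosh d|^2\<close>, and
  \<open>h\<close> itself meets the eigenvalue equation of \<open>cosh d\<close>. In polar form the
  bracket is \<open>sinh^(1 - N) (h sinh^N)'\<close>.\<close>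

lemma radial_field_divergence:
  fixes a :: "'a::euclidean_space"
  assumes a: "a \<in> hyp_space" and x: "x \<in> hyp_space" and neq: "x \<noteq> a" and dim: "DIM('a) = M + 2"
  shows "(\<Sum>b\<in>Basis. radial_field_deriv a h h' M b x b) = conf_factor x ^ (M + 2) *
    (h' (hdist a x) * sinh (hdist a x) + real (M + 2) * h (hdist a x) * cosh (hdist a x))"
proof -
  define s where "s = sinh (hdist a x)"
  have s: "0 < s" using hdist_pos [OF a x neq] by (simp add: s_def)
  have s2: "(hcosh a x)\<^sup>2 - 1 = s\<^sup>2"
    by (simp add: s_def sinh_square_eq cosh_hdist a x)
  have "(\<Sum>b\<in>Basis. radial_field_deriv a h h' M b x b) =
     h' (hdist a x) / s * conf_factor x ^ M * (\<Sum>b\<in>Basis. (hcosh_grad a x \<bullet> b) * (hcosh_grad a x \<bullet> b))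
     + h (hdist a x) * (\<Sum>b\<in>Basis. real M * conf_factor x ^ Suc M * (x \<bullet> b) * (hcosh_grad a x \<bullet> b)
         + conf_factor x ^ M * (hcosh_hess a x b \<bullet> b))"
    unfolding radial_field_deriv_def sum.distrib sum_distrib_left s_def [symmetric]
    by (simp only: mult_ac ring_distribs sum.distrib sum_distrib_left)
  also have "\<dots> = h' (hdist a x) / s * conf_factor x ^ M * ((conf_factor x)\<^sup>2 * s\<^sup>2)
     + h (hdist a x) * (conf_factor x ^ (M + 2) * (real (M + 2) * cosh (hdist a x)))"
    unfolding divergence_hcosh_grad [OF x a dim] euclidean_inner [symmetric] norm_hcosh_grad [OF x a] s2
    by (simp add: cosh_hdist a x)
  also have "\<dots> = conf_factor x ^ (M + 2) * (h' (hdist a x) * s + real (M + 2) * h (hdist a x) * cosh (hdist a x))"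
    using s by (simp add: power_add power2_eq_square ring_distribs)
  finally show ?thesis by (simp add: s_def)
qed

text \<open>The gradient of a radial function is the radial field with
  \<open>h = \<phi>' / sinh\<close>, so its divergence is already known.\<close>

lemma hlaplacian_radial:
  fixes a :: "'a::euclidean_space"
  assumes a: "a \<in> hyp_space" and dim: "DIM('a) = M + 2"
    and S: "open S" "S \<subseteq> hyp_space - {a}" and x: "x \<in> S"
    and u: "\<And>y. y \<in> hyp_space \<Longrightarrow> u y = \<phi> (hdist a y)"
    and \<phi>: "\<And>y. y \<in> S \<Longrightarrow> (\<phi> has_real_derivative \<phi>' (hdist a y)) (at (hdist a y))"
    and \<phi>': "(\<phi>' has_real_derivative \<phi>'') (at (hdist a x))"
  shows "hlaplacian u x = \<phi>'' + real (M + 1) * \<phi>' (hdist a x) * cosh (hdist a x) / sinh (hdist a x)"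
proof -
  have xS: "x \<in> hyp_space" "x \<noteq> a" using S x by auto
  define h where "h r = \<phi>' r / sinh r" for r
  \<comment> \<open>Since \<open>\<phi>''\<close> is a number, \<open>h'\<close> is the derivative
    of \<open>h\<close> only at the distance of \<open>x\<close>; the divergence at \<open>x\<close>
    uses no other value.\<close>
  define h' where "h' r = \<phi>'' / sinh r - \<phi>' r * cosh r / (sinh r)\<^sup>2" for r
  have s: "0 < sinh (hdist a x)" using hdist_pos [OF a xS] by simp
  have dh: "(h has_real_derivative h' (hdist a x)) (at (hdist a x))"
    unfolding h_def [abs_def] h'_def using s
    by (auto intro!: derivative_eq_intros \<phi>' simp: field_simps power2_eq_square)
  \<comment> \<open>The identity is established on the whole open set because \<open>hdiv\<close>
    differentiates the field.\<close>
  have field: "conf_factor y ^ DIM('a) * (hgrad u y \<bullet> b) = radial_field a h M b y" if y: "y \<in> S" for y b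
  proof -
    have yS: "y \<in> hyp_space" "y \<noteq> a" using S y by auto
    have "((\<lambda>y. \<phi> (hdist a y)) has_derivative
        (\<lambda>v. \<phi>' (hdist a y) / sinh (hdist a y) * (hcosh_grad a y \<bullet> v))) (at y)"
      by (rule has_derivative_radial [OF a yS \<phi> [OF y]])
    then have "(u has_derivative (\<lambda>v. \<phi>' (hdist a y) / sinh (hdist a y) * (hcosh_grad a y \<bullet> v))) (at y)"
      by (rule has_derivative_transform_within_open [OF _ open_hyp_space yS(1)]) (simp add: u)
    then have "hgrad u y = (1 / (conf_factor y)\<^sup>2) *\<^sub>R ((\<phi>' (hdist a y) / sinh (hdist a y)) *\<^sub>R hcosh_grad a y)"
      by (intro hgrad_eq) simp
    then show ?thesis
      using conf_factor_pos [OF yS(1)] by (simp add: radial_field_def h_def dim power_add power2_eq_square)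
  qed
  have "partial_deriv b (\<lambda>y. conf_factor y ^ DIM('a) * (hgrad u y \<bullet> b)) x = radial_field_deriv a h h' M b x b" for b
    by (rule partial_deriv_eqI, rule has_derivative_transform_within_open [OF has_derivative_radial_field [where h = h and h' = h', OF a xS dh] S(1) x])
       (simp add: field)
  then have "hlaplacian u x = (\<Sum>b\<in>Basis. radial_field_deriv a h h' M b x b) / conf_factor x ^ DIM('a)"
    by (simp add: hlaplacian_def hdiv_def)
  also have "\<dots> = h' (hdist a x) * sinh (hdist a x) + real (M + 2) * h (hdist a x) * cosh (hdist a x)"
    using conf_factor_pos [OF xS(1)] by (simp add: radial_field_divergence [OF a xS dim] dim)
  also have "\<dots> = \<phi>'' + real (M + 1) * \<phi>' (hdist a x) * cosh (hdist a x) / sinh (hdist a x)"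
    using s by (simp add: h_def h'_def field_simps power2_eq_square)
  finally show ?thesis .
qed

lemma continuous_on_radial_field_deriv:
  assumes a: "a \<in> hyp_space" and S: "S \<subseteq> hyp_space - {a}"
    and h: "continuous_on (hdist a ` S) h" "continuous_on (hdist a ` S) h'"
  shows "continuous_on S (\<lambda>x. radial_field_deriv a h h' M b x v)"
proof -
  have sub: "S \<subseteq> hyp_space" using S by auto
  note c = continuous_on_subset [OF _ sub]
  have d: "continuous_on S (hdist a)" by (rule c [OF continuous_on_hdist [OF a]])
  have "sinh (hdist a x) \<noteq> 0" if "x \<in> S" for x
  proof -
    have "x \<in> hyp_space" "x \<noteq> a" using S that by auto
    then show ?thesis using hdist_pos [OF a] by force
  qed
  moreover have "continuous_on S (\<lambda>x. h (hdist a x))" "continuous_on S (\<lambda>x. h' (hdist a x))"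
    by (auto intro: continuous_on_compose2 [OF h(1) d] continuous_on_compose2 [OF h(2) d])
  moreover note c [OF continuous_on_conf_factor] c [OF continuous_on_hcosh_grad [OF a]]
     c [OF continuous_on_hcosh_hess [OF a]] continuous_on_sinh [OF d]
  ultimately show ?thesis
    unfolding radial_field_deriv_def
    by (intro continuous_on_add continuous_on_mult continuous_on_divide continuous_on_inner
        continuous_on_power continuous_on_const continuous_on_id) auto
qed

section \<open>Divergence theorem for compact supports\<close>

lemma integral_directional_derivative_eq_0:
  fixes g :: "'a::euclidean_space \<Rightarrow> real"
  assumes g: "\<And>x. (g has_derivative g' x) (at x)" and cont: "continuous_on UNIV (\<lambda>x. g' x b)"
    and K: "compact K" and zero: "\<And>x. x \<notin> K \<Longrightarrow> g x = 0"
  shows "(LINT x|lborel. g' x b) = 0"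
proof -
  define q where "q n x = (g (x + (1 / real (Suc n)) *\<^sub>R b) - g x) * real (Suc n)" for n x
  have contg: "continuous_on UNIV g"
    by (intro continuous_at_imp_continuous_on ballI has_derivative_continuous [OF g])
  then have gm [measurable]: "g \<in> borel_measurable borel" by (rule borel_measurable_continuous_onI)
  have g'm [measurable]: "(\<lambda>x. g' x b) \<in> borel_measurable borel" by (rule borel_measurable_continuous_onI [OF cont])
  have g'0: "g' x b = 0" if "x \<notin> K" for x
  proof -
    have "((\<lambda>x. 0) has_derivative g' x) (at x)"
      by (rule has_derivative_transform_within_open [OF g open_Compl [OF compact_imp_closed [OF K]]])
         (use that zero in auto)
    then have "g' x = (\<lambda>x. 0)" by (rule has_derivative_unique) simp
    then show ?thesis by simp
  qed
  obtain B where B: "\<And>x. \<bar>g' x b\<bar> \<le> B"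
  proof -
    have "bounded ((\<lambda>x. g' x b) ` K)"
      by (intro compact_imp_bounded compact_continuous_image K continuous_on_subset [OF cont]) auto
    then obtain B where "\<And>x. x \<in> K \<Longrightarrow> \<bar>g' x b\<bar> \<le> B" by (auto simp: bounded_iff)
    then have "\<bar>g' x b\<bar> \<le> max B 0" for x
      using g'0 [of x] by (cases "x \<in> K") (auto simp: le_max_iff_disj)
    then show thesis by (rule that)
  qed
  obtain r where r: "\<And>x. x \<in> K \<Longrightarrow> norm x \<le> r" using compact_imp_bounded [OF K] by (auto simp: bounded_iff)
  have line: "((\<lambda>t. g (x + t *\<^sub>R b)) has_real_derivative g' (x + t *\<^sub>R b) b) (at t)" for x t
  proof -
    have "((\<lambda>t. g (x + t *\<^sub>R b)) has_derivative (\<lambda>h. g' (x + t *\<^sub>R b) (h *\<^sub>R b))) (at t)"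
      by (rule has_derivative_compose [OF _ g]) (auto intro!: derivative_eq_intros)
    moreover have "g' (x + t *\<^sub>R b) (h *\<^sub>R b) = g' (x + t *\<^sub>R b) b * h" for h
      using linear_scale [OF has_derivative_linear [OF g]] by simp
    ultimately show ?thesis by (simp add: has_field_derivative_def)
  qed
  have intg: "integrable lborel g"
  proof -
    have "integrable lborel (\<lambda>x. indicator K x *\<^sub>R g x)"
      by (rule borel_integrable_compact [OF K continuous_on_subset [OF contg]]) simp
    moreover have "(\<lambda>x. indicator K x *\<^sub>R g x) = g" using zero by (auto simp: fun_eq_iff indicator_def)
    ultimately show ?thesis by simp
  qed
  have trans: "has_bochner_integral lborel (\<lambda>x. g (x + c)) (integral\<^sup>L lborel g)" for c
  proof -
    have "has_bochner_integral (distr lborel borel (\<lambda>x. c + x)) g (integral\<^sup>L lborel g)"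
      by (simp add: lborel_distr_plus has_bochner_integral_integrable intg)
    then have "has_bochner_integral lborel (\<lambda>x. g (c + x)) (integral\<^sup>L lborel g)"
      by (simp add: has_bochner_integral_iff integrable_distr_eq integral_distr)
    then show ?thesis by (simp add: add.commute)
  qed
  have q0: "integral\<^sup>L lborel (q n) = 0" for n
  proof -
    have "has_bochner_integral lborel (q n) ((integral\<^sup>L lborel g - integral\<^sup>L lborel g) * real (Suc n))"
      unfolding q_def by (intro has_bochner_integral_mult_left has_bochner_integral_diff trans has_bochner_integral_integrable intg)
    then show ?thesis by (simp add: has_bochner_integral_integral_eq)
  qed
  have "(\<lambda>n. integral\<^sup>L lborel (q n)) \<longlonglongrightarrow> (LINT x|lborel. g' x b)"
  \<comment> \<open>Translation steps have length at most \<open>norm b\<close>, so every difference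
    quotient vanishes outside the ball of radius \<open>r + norm b\<close>. Inside it, the mean
    value theorem bounds the quotient by \<open>B\<close>.\<close>
  proof (rule integral_dominated_convergence [where w = "\<lambda>x. indicator (cball 0 (r + norm b)) x *\<^sub>R B"])
    show "(\<lambda>x. g' x b) \<in> borel_measurable lborel" by simp
    show "q n \<in> borel_measurable lborel" for n unfolding q_def by measurable
    show "integrable lborel (\<lambda>x::'a. indicator (cball 0 (r + norm b)) x *\<^sub>R B)"
      by (rule borel_integrable_compact) auto
    show "AE x in lborel. (\<lambda>n. q n x) \<longlonglongrightarrow> g' x b"
    proof (rule AE_I2)
      fix x
      have "(\<lambda>h. (g (x + h *\<^sub>R b) - g x) / h) \<midarrow>0\<rightarrow> g' x b"
        using line [of x 0] by (simp add: DERIV_def)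
      moreover have "filterlim (\<lambda>n. 1 / real (Suc n)) (at 0) sequentially"
        using LIMSEQ_inverse_real_of_nat by (simp add: filterlim_at inverse_eq_divide)
      ultimately have "(\<lambda>n. (g (x + (1 / real (Suc n)) *\<^sub>R b) - g x) / (1 / real (Suc n))) \<longlonglongrightarrow> g' x b"
        by (rule filterlim_compose)
      then show "(\<lambda>n. q n x) \<longlonglongrightarrow> g' x b" by (simp add: q_def)
    qed
    show "AE x in lborel. norm (q n x) \<le> indicator (cball 0 (r + norm b)) x *\<^sub>R B" for n
    proof (rule AE_I2)
      fix x
      define e where "e = 1 / real (Suc n)"
      have e: "0 < e" "e \<le> 1" "e * real (Suc n) = 1" by (auto simp: e_def)
      show "norm (q n x) \<le> indicator (cball 0 (r + norm b)) x *\<^sub>R B"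
      proof (cases "x \<in> cball 0 (r + norm b)")
        case True
        obtain z where "g (x + e *\<^sub>R b) - g (x + 0 *\<^sub>R b) = (e - 0) * g' (x + z *\<^sub>R b) b"
          using MVT2 [of 0 e "\<lambda>t. g (x + t *\<^sub>R b)" "\<lambda>t. g' (x + t *\<^sub>R b) b", OF e(1) line] by blast
        then have "q n x = (e * real (Suc n)) * g' (x + z *\<^sub>R b) b"
          unfolding q_def e_def [symmetric] by simp
        then have "q n x = g' (x + z *\<^sub>R b) b" unfolding e(3) by simp
        then show ?thesis using B True by simp
      next
        case False
        have "norm (e *\<^sub>R b) \<le> norm b" using e by (simp add: mult_left_le_one_le)
        moreover have "norm x \<le> norm (x + e *\<^sub>R b) + norm (e *\<^sub>R b)"
          using norm_triangle_ineq4 [of "x + e *\<^sub>R b" "e *\<^sub>R b"] by simp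
        moreover have "r + norm b < norm x" using False by simp
        ultimately have "\<not> norm x \<le> r" "\<not> norm (x + e *\<^sub>R b) \<le> r"
          using norm_ge_zero [of b] by linarith+
        then have "x \<notin> K" "x + e *\<^sub>R b \<notin> K" using r by blast+
        then show ?thesis using False zero unfolding q_def e_def [symmetric] by simp
      qed
    qed
  qed
  then show ?thesis by (simp add: q0 LIMSEQ_const_iff)
qed

text \<open>Extension by zero reduces this to the whole space. The extension is differentiable
  everywhere because the open sets \<open>S\<close> and \<open>- K\<close> cover the space and it
  vanishes on the latter.\<close>

lemma set_integral_directional_derivative_eq_0:
  fixes g :: "'a::euclidean_space \<Rightarrow> real"
  assumes S: "open S" and K: "compact K" "K \<subseteq> S"
    and g: "\<And>x. x \<in> S \<Longrightarrow> (g has_derivative g' x) (at x)" and cont: "continuous_on S (\<lambda>x. g' x b)"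
    and zero: "\<And>x. x \<in> S - K \<Longrightarrow> g x = 0"
  shows "set_integrable lborel S (\<lambda>x. g' x b)" "(LINT x:S|lborel. g' x b) = 0"
proof -
  define G where "G x = (if x \<in> S then g x else 0)" for x
  define G' where "G' x v = (if x \<in> S then g' x v else 0)" for x v
  have cl: "open (- K)" using compact_imp_closed [OF K(1)] by auto
  have G0: "G x = 0" if "x \<notin> K" for x using that zero by (auto simp: G_def)
  have zz: "g' x = (\<lambda>v. 0)" if "x \<in> S" "x \<notin> K" for x
  proof -
    have "((\<lambda>x. 0) has_derivative g' x) (at x)"
      by (rule has_derivative_transform_within_open [OF g open_Diff [OF S compact_imp_closed [OF K(1)]]])
         (use that zero in auto)
    then show ?thesis by (rule has_derivative_unique) simp
  qed
  then have z: "G' x = (\<lambda>v. 0)" if "x \<notin> K" for x using that by (auto simp: G'_def [abs_def])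
  have G: "(G has_derivative G' x) (at x)" for x
  proof (cases "x \<in> S")
    case True
    have "(G has_derivative g' x) (at x)"
      by (rule has_derivative_transform_within_open [OF g [OF True] S True]) (simp add: G_def)
    then show ?thesis using True by (simp add: G'_def [abs_def])
  next
    case False
    then have "x \<in> - K" using K by auto
    have "(G has_derivative (\<lambda>v. 0)) (at x)"
      by (rule has_derivative_transform_within_open [OF has_derivative_const cl \<open>x \<in> - K\<close>]) (simp add: G0)
    then show ?thesis using z \<open>x \<in> - K\<close> by simp
  qed
  have "continuous_on (S \<union> - K) (\<lambda>x. G' x b)"
  proof (rule continuous_on_open_Un [OF S cl])
    show "continuous_on S (\<lambda>x. G' x b)" by (rule continuous_on_eq [OF cont]) (simp add: G'_def)
    show "continuous_on (- K) (\<lambda>x. G' x b)" by (rule continuous_on_eq [OF continuous_on_const [of _ 0]]) (simp add: z)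
  qed
  moreover have "S \<union> - K = UNIV" using K by auto
  ultimately have contG: "continuous_on UNIV (\<lambda>x. G' x b)" by simp
  have ind: "(\<lambda>x. indicator S x *\<^sub>R g' x b) = (\<lambda>x. G' x b)" by (auto simp: G'_def)
  have ind': "(\<lambda>x. indicator K x *\<^sub>R G' x b) = (\<lambda>x. G' x b)"
  proof
    show "indicator K x *\<^sub>R G' x b = G' x b" for x by (cases "x \<in> K") (simp_all add: z)
  qed
  have "integrable lborel (\<lambda>x. indicator K x *\<^sub>R G' x b)"
    by (rule borel_integrable_compact [OF K(1) continuous_on_subset [OF contG]]) simp
  then show "set_integrable lborel S (\<lambda>x. g' x b)"
    unfolding set_integrable_def ind ind' .
  show "(LINT x:S|lborel. g' x b) = 0"
    unfolding set_lebesgue_integral_def ind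
    by (rule integral_directional_derivative_eq_0 [OF G contG K(1) G0])
qed

text \<open>Passage to Lebesgue measure with weight \<open>\<lambda>^N\<close>. Continuity of
  \<open>F\<close> on the open set \<open>S\<close> provides the measurability that the density
  theorems require.\<close>

lemma
  fixes F :: "'a::euclidean_space \<Rightarrow> real"
  assumes S: "open S" "S \<subseteq> hyp_space" and F: "continuous_on S F"
  shows set_integrable_hvol_iff: "set_integrable hvol S F \<longleftrightarrow> set_integrable lborel S (\<lambda>x. conf_factor x ^ DIM('a) * F x)"
    and set_integral_hvol: "(LINT x:S|hvol. F x) = (LINT x:S|lborel. conf_factor x ^ DIM('a) * F x)"
proof -
  let ?R = "restrict_space lborel (hyp_space :: 'a set)"
  have Sm: "S \<in> sets borel" and hm: "(hyp_space :: 'a set) \<in> sets borel" using S borel_open [OF open_hyp_space] by auto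
  have sp: "space ?R = hyp_space" by (simp add: space_restrict_space)
  have Fm: "(\<lambda>x. indicator S x *\<^sub>R F x) \<in> borel_measurable ?R"
    using borel_measurable_continuous_on_indicator [OF Sm F]
    by (intro measurable_restrict_space1) simp
  have cm: "(\<lambda>x. conf_factor x ^ DIM('a)) \<in> borel_measurable ?R"
    using borel_measurable_continuous_on_indicator [OF hm continuous_on_power [OF continuous_on_conf_factor]]
    by (subst borel_measurable_restrict_space_iff) (use hm in auto)
  have nn: "AE x in ?R. 0 \<le> conf_factor x ^ DIM('a)"
    by (rule AE_I2) (simp add: sp conf_factor_pos less_imp_le)
  have ind: "indicator (hyp_space) x *\<^sub>R (conf_factor x ^ DIM('a) *\<^sub>R indicator S x *\<^sub>R F x)
     = indicator S x *\<^sub>R (conf_factor x ^ DIM('a) * F x)" for x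
    using S(2) by (auto simp: indicator_def)
  have hm': "hyp_space \<inter> space lborel \<in> sets (lborel :: 'a measure)" using hm by simp
  show "set_integrable hvol S F \<longleftrightarrow> set_integrable lborel S (\<lambda>x. conf_factor x ^ DIM('a) * F x)"
    unfolding set_integrable_def hvol_def integrable_density [OF Fm cm nn] integrable_restrict_space [OF hm'] ind ..
  show "(LINT x:S|hvol. F x) = (LINT x:S|lborel. conf_factor x ^ DIM('a) * F x)"
    unfolding set_lebesgue_integral_def hvol_def integral_density [OF Fm cm nn] integral_restrict_space [OF hm'] ind ..
qed

text \<open>The density blows up at the boundary of the ball, but stays bounded on the compact set
  \<open>K\<close>.\<close>

lemma set_integrable_hvol_compact_support:
  fixes F :: "'a::euclidean_space \<Rightarrow> real"
  assumes S: "open S" "S \<subseteq> hyp_space" and K: "compact K" "K \<subseteq> S" and F: "continuous_on S F"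
    and zero: "\<And>x. x \<in> S - K \<Longrightarrow> F x = 0"
  shows "set_integrable hvol S F"
proof -
  have ind: "(\<lambda>x. indicator K x *\<^sub>R (conf_factor x ^ DIM('a) * F x))
      = (\<lambda>x. indicator S x *\<^sub>R (conf_factor x ^ DIM('a) * F x))"
    using K(2) zero by (auto simp: indicator_def fun_eq_iff)
  have "integrable lborel (\<lambda>x. indicator K x *\<^sub>R (conf_factor x ^ DIM('a) * F x))"
    by (intro borel_integrable_compact K continuous_intros continuous_on_subset [OF F]
        continuous_on_subset [OF continuous_on_conf_factor]) (use S K in auto)
  then show ?thesis
    unfolding set_integrable_hvol_iff [OF S F] unfolding set_integrable_def ind .
qed

text \<open>The integrals of the theorem include the pole, where quotients by \<open>sinh d\<close>
  and \<open>d\<close> take the default value of division by 0. Points are null sets of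
  \<open>hvol\<close>, so the pole may be dropped.\<close>

lemma set_integral_hvol_remove_point:
  fixes F :: "'a::euclidean_space \<Rightarrow> real"
  assumes a: "a \<in> hyp_space"
  shows "(LINT x:A|hvol. F x) = (LINT x:A - {a}|hvol. F x)"
  unfolding set_lebesgue_integral_def
proof (rule integral_discrete_difference [of "{a}"])
  let ?R = "restrict_space lborel (hyp_space :: 'a set)"
  have hm: "(hyp_space :: 'a set) \<in> sets borel" by (rule borel_open [OF open_hyp_space])
  have "{a} = {a} \<inter> hyp_space" using a by auto
  then have s: "{a} \<in> sets ?R" using hm by (auto simp: sets_restrict_space_iff)
  then show "{x} \<in> sets hvol" if "x \<in> {a}" for x using that by (simp add: hvol_def)
  have cm: "(\<lambda>x. conf_factor x ^ DIM('a)) \<in> borel_measurable ?R"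
    using borel_measurable_continuous_on_indicator [OF hm continuous_on_power [OF continuous_on_conf_factor]]
    by (subst borel_measurable_restrict_space_iff) (use hm in auto)
  have "emeasure ?R {a} = 0" using hm a by (subst emeasure_restrict_space) auto
  then have "{a} \<in> null_sets ?R" using s by (intro null_setsI)
  then have "{a} \<in> null_sets hvol"
    unfolding hvol_def using absolutely_continuousI_density [of "\<lambda>x. ennreal (conf_factor x ^ DIM('a))" ?R] cm
    by (auto simp: absolutely_continuous_def)
  then show "emeasure hvol {x} = 0" if "x \<in> {a}" for x using that by auto
qed (auto simp: indicator_def)

section \<open>Radial profiles of smooth functions\<close>

text \<open>The pointwise core. With \<open>n = N - 1\<close>, \<open>v\<close> and \<open>z\<close>
  the first two radial derivatives of \<open>u\<close>, and \<open>s\<close>, \<open>c\<close> the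
  hyperbolic sine and cosine, the left side is \<open>h' s + (n + 1) h c\<close>, where
  \<open>(V f')'\<close> has been replaced through the Bessel equation.\<close>

lemma integrand_identity:
  fixes n V V' W v z s c f f' r :: real
  assumes s: "s \<noteq> 0" and f: "f \<noteq> 0" and cs: "c\<^sup>2 = s\<^sup>2 + 1"
  shows "(n * (V' * v\<^sup>2 * c / s\<^sup>2 + 2 * V * v * z * c / s\<^sup>2 + V * v\<^sup>2 * (1 / s - 2 * c\<^sup>2 / s ^ 3))
          + ((- W * f - n / r * (V * f')) * v\<^sup>2 / (s * f) + 2 * (V * f') * v * z / (s * f)
             - (V * f') * v\<^sup>2 * c / (s\<^sup>2 * f) - (V * f') * v\<^sup>2 * f' / (s * f\<^sup>2))) * s
     + (n + 1) * (n * V * v\<^sup>2 * c / s\<^sup>2 + (V * f') * v\<^sup>2 / (s * f)) * c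
    = V * (z + n * v * c / s)\<^sup>2
      - (W * v\<^sup>2 + n * ((V / s\<^sup>2 - V' * c / s) * v\<^sup>2) - n * (V * (f' / f) * (c / s - 1 / r) * v\<^sup>2)
         + V * f\<^sup>2 * (z / f - v * f' / f\<^sup>2)\<^sup>2)"
proof -
  \<comment> \<open>With the reciprocals as symbols, the claim becomes polynomial modulo
    \<open>s i = 1\<close>, \<open>f j = 1\<close> and \<open>c^2 = s^2 + 1\<close>.\<close>
  define i j k where "i = 1 / s" and "j = 1 / f" and "k = 1 / r"
  have e: "x / s = x * i" "x / s\<^sup>2 = x * i\<^sup>2" "x / s ^ 3 = x * i ^ 3" "x / f = x * j" "x / f\<^sup>2 = x * j\<^sup>2"
     "x / (s * f) = x * i * j" "x / (s\<^sup>2 * f) = x * i\<^sup>2 * j" "x / (s * f\<^sup>2) = x * i * j\<^sup>2" "x / r = x * k" for x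
    by (simp_all add: i_def j_def k_def power_divide)
  have rel: "s * i = 1" "f * j = 1" using s f by (simp_all add: i_def j_def)
  show ?thesis unfolding e using rel cs by algebra
qed

text \<open>The chain rule is phrased through partial derivatives because \<open>Ck_on\<close>
  iterates these; the rule can then be applied to them again.\<close>

lemma has_real_derivative_along_curve:
  fixes u :: "'a::euclidean_space \<Rightarrow> real"
  assumes u: "u differentiable (at (\<gamma> r))" and \<gamma>: "(\<gamma> has_vector_derivative \<gamma>') (at r)"
  shows "((\<lambda>r. u (\<gamma> r)) has_real_derivative (\<Sum>b\<in>Basis. partial_deriv b u (\<gamma> r) * (\<gamma>' \<bullet> b))) (at r)"
proof -
  define D where "D = frechet_derivative u (at (\<gamma> r))"
  have D: "(u has_derivative D) (at (\<gamma> r))" using u by (simp add: D_def frechet_derivative_works)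
  have lin: "linear D" by (rule has_derivative_linear [OF D])
  have "((\<lambda>r. u (\<gamma> r)) has_derivative (\<lambda>h. D (h *\<^sub>R \<gamma>'))) (at r)"
    by (rule has_derivative_compose [OF \<gamma> [unfolded has_vector_derivative_def] D])
  moreover have "D (h *\<^sub>R \<gamma>') = (\<Sum>b\<in>Basis. partial_deriv b u (\<gamma> r) * (\<gamma>' \<bullet> b)) * h" for h
  proof -
    have pd: "partial_deriv b u (\<gamma> r) = D b" for b by (rule partial_deriv_eqI [OF D])
    have "D \<gamma>' = D (\<Sum>b\<in>Basis. (\<gamma>' \<bullet> b) *\<^sub>R b)" by (simp add: euclidean_representation)
    also have "\<dots> = (\<Sum>b\<in>Basis. partial_deriv b u (\<gamma> r) * (\<gamma>' \<bullet> b))"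
      by (simp add: linear_sum [OF lin] linear_scale [OF lin] pd mult.commute)
    finally show ?thesis by (simp add: linear_scale [OF lin])
  qed
  ultimately show ?thesis by (simp add: has_field_derivative_def)
qed

text \<open>Two applications of the chain rule. Along a ray with
  \<open>hdist a (\<gamma> r) = r\<close>, a radial \<open>u\<close> restricts to its profile, which
  thereby inherits the smoothness of \<open>u\<close>.\<close>

lemma C2_along_curve:
  fixes u :: "'a::euclidean_space \<Rightarrow> real"
  assumes u: "Ck_on (Suc (Suc 0)) u S" and I: "open I" and \<gamma>S: "\<And>r. r \<in> I \<Longrightarrow> \<gamma> r \<in> S"
    and \<gamma>: "\<And>r. r \<in> I \<Longrightarrow> (\<gamma> has_vector_derivative \<gamma>1 r) (at r)"
    and \<gamma>1: "\<And>r. r \<in> I \<Longrightarrow> (\<gamma>1 has_vector_derivative \<gamma>2 r) (at r)" and \<gamma>2: "continuous_on I \<gamma>2"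
    and \<phi>: "\<And>r. r \<in> I \<Longrightarrow> \<phi> r = u (\<gamma> r)"
  shows "\<exists>\<phi>1 \<phi>2. (\<forall>r\<in>I. (\<phi> has_real_derivative \<phi>1 r) (at r)) \<and>
    (\<forall>r\<in>I. (\<phi>1 has_real_derivative \<phi>2 r) (at r)) \<and> continuous_on I \<phi>2"
proof -
  have du: "u differentiable (at x)" and ddu: "b \<in> Basis \<Longrightarrow> partial_deriv b u differentiable (at x)" if "x \<in> S" for x b
    using u that by auto
  have dd: "continuous_on S (partial_deriv c (partial_deriv b u))" if "b \<in> Basis" "c \<in> Basis" for b c
    using u that by auto
  define \<phi>1 where "\<phi>1 r = (\<Sum>b\<in>Basis. partial_deriv b u (\<gamma> r) * (\<gamma>1 r \<bullet> b))" for r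
  define \<phi>2 where "\<phi>2 r = (\<Sum>b\<in>Basis. (\<Sum>c\<in>Basis. partial_deriv c (partial_deriv b u) (\<gamma> r) * (\<gamma>1 r \<bullet> c)) * (\<gamma>1 r \<bullet> b)
      + (\<gamma>2 r \<bullet> b) * partial_deriv b u (\<gamma> r))" for r
  have "(\<phi> has_real_derivative \<phi>1 r) (at r)" if r: "r \<in> I" for r
  proof (rule has_field_derivative_transform_within_open [OF _ I r])
    show "((\<lambda>r. u (\<gamma> r)) has_real_derivative \<phi>1 r) (at r)"
      unfolding \<phi>1_def by (rule has_real_derivative_along_curve [OF du [OF \<gamma>S [OF r]] \<gamma> [OF r]])
  qed (simp add: \<phi>)
  moreover have "(\<phi>1 has_real_derivative \<phi>2 r) (at r)" if r: "r \<in> I" for r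
  proof -
    have "((\<lambda>r. \<gamma>1 r \<bullet> b) has_real_derivative \<gamma>2 r \<bullet> b) (at r)" for b
      using has_derivative_inner_left [OF \<gamma>1 [OF r, unfolded has_vector_derivative_def], of b]
      by (simp add: has_field_derivative_def mult_commute_abs)
    then show ?thesis
      unfolding \<phi>1_def [abs_def] \<phi>2_def
      by (intro DERIV_sum DERIV_mult has_real_derivative_along_curve ddu \<gamma>S \<gamma> r)
  qed
  moreover have "continuous_on I \<phi>2"
  proof -
    have c\<gamma>: "continuous_on I \<gamma>"
      by (intro continuous_at_imp_continuous_on ballI has_vector_derivative_continuous [OF \<gamma>])
    have c\<gamma>1: "continuous_on I \<gamma>1"
      by (intro continuous_at_imp_continuous_on ballI has_vector_derivative_continuous [OF \<gamma>1])
    have sub: "\<gamma> ` I \<subseteq> S" using \<gamma>S by auto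
    have "continuous_on S (partial_deriv b u)" if "b \<in> Basis" for b
      by (intro continuous_at_imp_continuous_on ballI differentiable_imp_continuous_within ddu that)
    then have "continuous_on I (\<lambda>r. partial_deriv b u (\<gamma> r))" if "b \<in> Basis" for b
      using continuous_on_compose2 [OF _ c\<gamma> sub] that by blast
    moreover have "continuous_on I (\<lambda>r. partial_deriv c (partial_deriv b u) (\<gamma> r))" if "b \<in> Basis" "c \<in> Basis" for b c
      using continuous_on_compose2 [OF dd c\<gamma> sub] that by blast
    ultimately show ?thesis
      unfolding \<phi>2_def by (intro continuous_on_sum continuous_on_add continuous_on_mult continuous_on_inner c\<gamma>1 \<gamma>2 continuous_on_const)
  qed
  ultimately show ?thesis by blast
qed

text \<open>The ray leaves \<open>a\<close> orthogonally to the direction of \<open>a\<close>, so that its time component in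
  hyperboloid coordinates is a multiple of \<open>cosh r\<close>.\<close>
lemma geodesic_ray_exists:
  fixes a :: "'a::euclidean_space"
  assumes a: "a \<in> hyp_space" and dim: "2 \<le> DIM('a)"
  shows "\<exists>\<gamma> \<gamma>1 \<gamma>2. (\<forall>r\<ge>0. \<gamma> r \<in> hyp_space \<and> hdist a (\<gamma> r) = r) \<and>
    (\<forall>r. (\<gamma> has_vector_derivative \<gamma>1 r) (at r)) \<and> (\<forall>r. (\<gamma>1 has_vector_derivative \<gamma>2 r) (at r)) \<and>
    continuous_on UNIV \<gamma>2"
proof -
  obtain y where y: "y \<noteq> 0" "orthogonal a y" using orthogonal_to_vector_exists [OF dim] by blast
  define e where "e = y /\<^sub>R norm y"
  have e: "e \<bullet> e = 1" "a \<bullet> e = 0"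
    using y by (auto simp: e_def orthogonal_def dot_square_norm power2_eq_square)
  define C A where "C = (1 + a \<bullet> a) / (1 - a \<bullet> a)" and "A = (2 / (1 - a \<bullet> a)) *\<^sub>R a"
  have CA: "C\<^sup>2 - A \<bullet> A = 1" "1 \<le> C" using hyperboloid_point [OF a] by (auto simp: C_def A_def)
  have Ae: "A \<bullet> e = 0" "e \<bullet> A = 0" using e by (auto simp: A_def inner_commute)
  define E where "E r = 1 + C * cosh r" for r :: real
  have E: "0 < E r" for r using CA(2) cosh_real_ge_1 [of r] by (simp add: E_def add_pos_pos)
  have dE: "(E has_real_derivative C * sinh r) (at r)" for r
    unfolding E_def by (auto intro!: derivative_eq_intros)
  \<comment> \<open>The space part of \<open>cosh r (C, A) + sinh r (0, e)\<close>, a unit-speed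
    geodesic of the hyperboloid, as \<open>(0, e)\<close> is a unit tangent vector at the lift of
    \<open>a\<close>. Its time part is \<open>C cosh r\<close>, and \<open>E\<close> is the
    denominator of the projection.\<close>
  define v where "v r = cosh r *\<^sub>R A + sinh r *\<^sub>R e" for r :: real
  define \<gamma> where "\<gamma> r = (cosh r / E r) *\<^sub>R A + (sinh r / E r) *\<^sub>R e" for r
  define \<gamma>1 where "\<gamma>1 r = (sinh r / (E r)\<^sup>2) *\<^sub>R A + ((cosh r + C) / (E r)\<^sup>2) *\<^sub>R e" for r
  define \<gamma>2 where "\<gamma>2 r = ((cosh r * E r - 2 * C * (sinh r)\<^sup>2) / (E r) ^ 3) *\<^sub>R A
     + ((sinh r * E r - 2 * C * sinh r * (cosh r + C)) / (E r) ^ 3) *\<^sub>R e" for r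
  have \<gamma>v: "\<gamma> r = (1 / (1 + C * cosh r)) *\<^sub>R v r" for r by (simp add: \<gamma>_def v_def E_def scaleR_add_right)
  have vv: "(C * cosh r)\<^sup>2 - v r \<bullet> v r = 1" for r
  proof -
    have "(C * cosh r)\<^sup>2 - v r \<bullet> v r = (cosh r)\<^sup>2 * (C\<^sup>2 - A \<bullet> A) - (sinh r)\<^sup>2"
      by (simp add: v_def inner_add_left inner_add_right Ae e power2_eq_square algebra_simps)
    then show ?thesis by (simp add: CA cosh_square_eq)
  qed
  have cpos: "0 < C * cosh r" for r using CA(2) by simp
  have in_hyp: "\<gamma> r \<in> hyp_space" for r
    unfolding \<gamma>v by (rule stereographic_in_hyp_space(1) [OF vv cpos])
  have "hcosh a (\<gamma> r) = cosh r" for r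
  proof -
    have m: "2 / (1 - \<gamma> r \<bullet> \<gamma> r) = E r"
      using stereographic_in_hyp_space(2) [OF vv cpos, of r] by (simp add: \<gamma>v conf_factor_inner E_def)
    have "1 - \<gamma> r \<bullet> \<gamma> r > 0" using in_hyp [of r] by (simp add: hyp_space_iff)
    then have "(1 + \<gamma> r \<bullet> \<gamma> r) / (1 - \<gamma> r \<bullet> \<gamma> r) = 2 / (1 - \<gamma> r \<bullet> \<gamma> r) - 1" by (simp add: field_simps)
    then have t: "(1 + \<gamma> r \<bullet> \<gamma> r) / (1 - \<gamma> r \<bullet> \<gamma> r) = C * cosh r" unfolding m by (simp add: E_def)
    have s: "(2 / (1 - \<gamma> r \<bullet> \<gamma> r)) *\<^sub>R \<gamma> r = v r"
      unfolding m unfolding \<gamma>v using E [of r] by (simp add: E_def)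
    \<comment> \<open>The Lorentz product with the starting point kills the \<open>e\<close>
      component and leaves \<open>cosh r\<close>.\<close>
    have "hcosh a (\<gamma> r) = C * (C * cosh r) - A \<bullet> v r"
      unfolding hcosh_lorentz [OF a in_hyp] t s by (simp add: C_def A_def)
    also have "\<dots> = cosh r * (C\<^sup>2 - A \<bullet> A)"
      by (simp add: v_def inner_add_right Ae power2_eq_square algebra_simps)
    finally show ?thesis by (simp add: CA)
  qed
  then have "hdist a (\<gamma> r) = r" if "0 \<le> r" for r
    using that by (simp add: hdist_eq a in_hyp arcosh_cosh_real)
  moreover have "(\<gamma> has_vector_derivative \<gamma>1 r) (at r)" for r
  proof -
    have nz: "E r \<noteq> 0" using E [of r] by simp
    have "((\<lambda>r. cosh r / E r) has_real_derivative (sinh r * E r - cosh r * (C * sinh r)) / (E r * E r)) (at r)"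
      using nz by (intro DERIV_divide dE) (auto intro!: derivative_eq_intros)
    moreover have "sinh r * E r - cosh r * (C * sinh r) = sinh r"
      by (simp add: E_def algebra_simps)
    moreover have "((\<lambda>r. sinh r / E r) has_real_derivative (cosh r * E r - sinh r * (C * sinh r)) / (E r * E r)) (at r)"
      using nz by (intro DERIV_divide dE) (auto intro!: derivative_eq_intros)
    moreover have "cosh r * E r - sinh r * (C * sinh r) = cosh r + C"
      using cosh_square_eq [of r] by (simp add: E_def algebra_simps power2_eq_square)
    ultimately have "((\<lambda>r. cosh r / E r) has_real_derivative sinh r / (E r)\<^sup>2) (at r)"
      "((\<lambda>r. sinh r / E r) has_real_derivative (cosh r + C) / (E r)\<^sup>2) (at r)"
      by (simp_all add: power2_eq_square)
    from has_vector_derivative_add [OF has_vector_derivative_scaleR [OF this(1) has_vector_derivative_const]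
        has_vector_derivative_scaleR [OF this(2) has_vector_derivative_const]]
    show ?thesis by (simp add: \<gamma>_def [abs_def] \<gamma>1_def)
  qed
  moreover have "(\<gamma>1 has_vector_derivative \<gamma>2 r) (at r)" for r
  proof -
    have dE2: "((\<lambda>r. (E r)\<^sup>2) has_real_derivative 2 * E r * (C * sinh r)) (at r)"
      by (rule derivative_eq_intros dE refl)+ simp
    have nz: "E r \<noteq> 0" using E [of r] by simp
    have "((\<lambda>r. sinh r / (E r)\<^sup>2) has_real_derivative
        (cosh r * (E r)\<^sup>2 - sinh r * (2 * E r * (C * sinh r))) / ((E r)\<^sup>2 * (E r)\<^sup>2)) (at r)"
      using nz by (intro DERIV_divide dE2 derivative_intros) (auto intro!: derivative_eq_intros)
    moreover have "(cosh r * (E r)\<^sup>2 - sinh r * (2 * E r * (C * sinh r))) / ((E r)\<^sup>2 * (E r)\<^sup>2)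
       = (cosh r * E r - 2 * C * (sinh r)\<^sup>2) / (E r) ^ 3"
      using nz by (simp add: field_simps power2_eq_square power3_eq_cube)
    moreover have "((\<lambda>r. (cosh r + C) / (E r)\<^sup>2) has_real_derivative
        (sinh r * (E r)\<^sup>2 - (cosh r + C) * (2 * E r * (C * sinh r))) / ((E r)\<^sup>2 * (E r)\<^sup>2)) (at r)"
      using nz by (intro DERIV_divide dE2) (auto intro!: derivative_eq_intros)
    moreover have "(sinh r * (E r)\<^sup>2 - (cosh r + C) * (2 * E r * (C * sinh r))) / ((E r)\<^sup>2 * (E r)\<^sup>2)
       = (sinh r * E r - 2 * C * sinh r * (cosh r + C)) / (E r) ^ 3"
      using nz by (simp add: field_simps power2_eq_square power3_eq_cube)
    ultimately have "((\<lambda>r. sinh r / (E r)\<^sup>2) has_real_derivative (cosh r * E r - 2 * C * (sinh r)\<^sup>2) / (E r) ^ 3) (at r)"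
      "((\<lambda>r. (cosh r + C) / (E r)\<^sup>2) has_real_derivative (sinh r * E r - 2 * C * sinh r * (cosh r + C)) / (E r) ^ 3) (at r)"
      by metis+
    from has_vector_derivative_add [OF has_vector_derivative_scaleR [OF this(1) has_vector_derivative_const]
        has_vector_derivative_scaleR [OF this(2) has_vector_derivative_const]]
    show ?thesis by (simp add: \<gamma>1_def [abs_def] \<gamma>2_def)
  qed
  moreover have "continuous_on UNIV \<gamma>2"
  proof -
    have "continuous_on UNIV E" unfolding E_def by (intro continuous_intros)
    moreover have "E r \<noteq> 0" for r using E [of r] by simp
    ultimately show ?thesis unfolding \<gamma>2_def by (intro continuous_intros) auto
  qed
  ultimately show ?thesis using in_hyp by blast
qed

section \<open>The integral identity\<close>

text \<open>That the distances of points of \<open>T\<close> fill a neighbourhood is bypassed: the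
  gradient of the composed function vanishes at \<open>x\<close>, and its norm is
  \<open>|h'|\<close>.\<close>

lemma radial_deriv_eq_0:
  assumes a: "a \<in> hyp_space" and T: "open T" "T \<subseteq> hyp_space - {a}" and x: "x \<in> T"
    and zero: "\<And>y. y \<in> T \<Longrightarrow> h (hdist a y) = 0" and h: "(h has_real_derivative h') (at (hdist a x))"
  shows "h' = 0"
proof -
  have xT: "x \<in> hyp_space" "x \<noteq> a" using T x by auto
  have "((\<lambda>y. h (hdist a y)) has_derivative (\<lambda>v. 0)) (at x)"
    by (rule has_derivative_transform_within_open [OF has_derivative_const T(1) x]) (simp add: zero)
  then have "hgrad (\<lambda>y. h (hdist a y)) x = 0"
    using hgrad_eq [of "\<lambda>y. h (hdist a y)" 0 x] by simp
  then show ?thesis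
    using hnorm_hgrad_radial [OF a xT h] by (simp add: hnorm_eq xT)
qed

text \<open>The density of \<open>hvol\<close> is exactly the factor \<open>\<lambda>^N\<close> in
  the coordinate divergence, so the integral is a sum over the basis of integrals of Euclidean
  partial derivatives.\<close>

lemma radial_divergence_theorem:
  fixes a :: "'a::euclidean_space"
  assumes a: "a \<in> hyp_space" and dim: "DIM('a) = M + 2"
    and S: "open S" "S \<subseteq> hyp_space - {a}" and K: "compact K" "K \<subseteq> S"
    and h: "\<And>x. x \<in> S \<Longrightarrow> (h has_real_derivative h' (hdist a x)) (at (hdist a x))"
    and h': "continuous_on (hdist a ` S) h'"
    and zero: "\<And>x. x \<in> S - K \<Longrightarrow> h (hdist a x) = 0"
  shows "(LINT x:S|hvol. h' (hdist a x) * sinh (hdist a x) + real (M + 2) * h (hdist a x) * cosh (hdist a x)) = 0"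
proof -
  have hyp: "x \<in> hyp_space" "x \<noteq> a" if "x \<in> S" for x using S that by auto
  have Sh: "S \<subseteq> hyp_space" using S by auto
  have ch: "continuous_on (hdist a ` S) h"
    using h by (auto intro!: continuous_at_imp_continuous_on DERIV_isCont)
  have d: "continuous_on S (hdist a)" by (rule continuous_on_subset [OF continuous_on_hdist [OF a] Sh])
  have int: "set_integrable lborel S (\<lambda>x. radial_field_deriv a h h' M b x b)"
    and int0: "(LINT x:S|lborel. radial_field_deriv a h h' M b x b) = 0" for b
    using set_integral_directional_derivative_eq_0 [OF S(1) K(1,2), of "radial_field a h M b" "radial_field_deriv a h h' M b" b]
      has_derivative_radial_field [of a _ h h' M b] continuous_on_radial_field_deriv [OF a S(2) ch h', of M b b]
      a hyp h zero by (auto simp: radial_field_def)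
  have cont: "continuous_on S (\<lambda>x. h' (hdist a x) * sinh (hdist a x) + real (M + 2) * h (hdist a x) * cosh (hdist a x))"
    by (intro continuous_intros d continuous_on_compose2 [OF ch d order_refl] continuous_on_compose2 [OF h' d order_refl])
  have "(LINT x:S|hvol. h' (hdist a x) * sinh (hdist a x) + real (M + 2) * h (hdist a x) * cosh (hdist a x))
     = (LINT x:S|lborel. (\<Sum>b\<in>Basis. radial_field_deriv a h h' M b x b))"
    unfolding set_integral_hvol [OF S(1) Sh cont] unfolding set_lebesgue_integral_def
    by (rule Bochner_Integration.integral_cong [OF refl])
       (auto simp: indicator_def radial_field_divergence [OF a hyp dim] dim)
  also have "\<dots> = (\<Sum>b\<in>Basis. (LINT x:S|lborel. radial_field_deriv a h h' M b x b))"
    using int unfolding set_lebesgue_integral_def set_integrable_def scaleR_sum_right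
    by (intro Bochner_Integration.integral_sum) auto
  finally show ?thesis by (simp add: int0)
qed

lemma C1_differentiable_on_open_deriv:
  fixes g :: "real \<Rightarrow> real"
  assumes g: "g C1_differentiable_on I" and I: "open I"
  shows "r \<in> I \<Longrightarrow> (g has_real_derivative deriv g r) (at r)" "continuous_on I (deriv g)"
proof -
  obtain D where D: "\<And>r. r \<in> I \<Longrightarrow> (g has_real_derivative D r) (at r)" and cD: "continuous_on I D"
    using g unfolding C1_differentiable_on_def has_real_derivative_iff_has_vector_derivative by blast
  have eq: "deriv g r = D r" if "r \<in> I" for r by (rule DERIV_imp_deriv [OF D [OF that]])
  show "r \<in> I \<Longrightarrow> (g has_real_derivative deriv g r) (at r)" using D eq by simp
  show "continuous_on I (deriv g)" by (rule continuous_on_eq [OF cD]) (simp add: eq)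
qed

text \<open>The Bessel hypotheses concern \<open>r^(N-1) V\<close> and \<open>r^(N-1) V f'\<close>;
  this extracts the derivatives of \<open>V\<close> and of \<open>V f'\<close>. It is also the
  source of the term with \<open>1 / r\<close>.\<close>

lemma has_real_derivative_cancel_power:
  fixes V :: "real \<Rightarrow> real"
  assumes "((\<lambda>s. s ^ Suc k * V s) has_real_derivative D) (at r)" and r: "0 < r"
  shows "(V has_real_derivative D / r ^ Suc k - real (Suc k) / r * V r) (at r)"
proof -
  have "((\<lambda>s. (s ^ Suc k * V s) / s ^ Suc k) has_real_derivative
     (D * r ^ Suc k - (r ^ Suc k * V r) * (real (Suc k) * r ^ k)) / (r ^ Suc k * r ^ Suc k)) (at r)"
    using r DERIV_pow [of "Suc k" r] by (intro DERIV_divide assms) auto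
  then have "((\<lambda>s. (s ^ Suc k * V s) / s ^ Suc k) has_real_derivative
     D / r ^ Suc k - real (Suc k) / r * V r) (at r)"
    by (rule DERIV_cong) (use r in \<open>simp add: diff_divide_distrib\<close>)
  then show ?thesis
    by (rule has_field_derivative_transform_within_open [of _ _ _ "{0<..}"]) (use r in auto)
qed

theorem theorem3p1:
  fixes x0 :: "'a::euclidean_space"
    and R :: ereal
    and V W f \<phi> :: "real \<Rightarrow> real"
    and u :: "'a \<Rightarrow> real"
  defines "N \<equiv> DIM('a)"
    and "d \<equiv> hdist x0"
    and "u\<^sub>r \<equiv> (\<lambda>x. deriv \<phi> (hdist x0 x))"
  assumes dim: "DIM('a) \<ge> 2"
    and pole: "x0 \<in> hyp_space"
    and R: "0 < R"
    and bessel: "bessel_pair (\<lambda>r. r ^ (N - 1) * V r) (\<lambda>r. r ^ (N - 1) * W r) R"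
    and solution: "positive_solution (\<lambda>r. r ^ (N - 1) * V r) (\<lambda>r. r ^ (N - 1) * W r) R f"
    and test: "u \<in> test_functions (hball x0 R - {x0})"
    and radial: "\<forall>x\<in>hyp_space. u x = \<phi> (d x)"
  shows "(LINT x:hball x0 R|hvol. V (d x) * \<bar>hlaplacian u x\<bar>\<^sup>2) =
      (LINT x:hball x0 R|hvol. W (d x) * (hnorm x (hgrad u x))\<^sup>2)
    + (real N - 1) * (LINT x:hball x0 R|hvol.
        (V (d x) / (sinh (d x))\<^sup>2 - deriv V (d x) * cosh (d x) / sinh (d x))
          * (hnorm x (hgrad u x))\<^sup>2)
    - (real N - 1) * (LINT x:hball x0 R|hvol.
        V (d x) * (deriv f (d x) / f (d x)) * (cosh (d x) / sinh (d x) - 1 / d x)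
          * (hnorm x (hgrad u x))\<^sup>2)
    + (LINT x:hball x0 R|hvol.
        V (d x) * (f (d x))\<^sup>2 * (hnorm x (hgrad (\<lambda>y. u\<^sub>r y / f (d y)) x))\<^sup>2)"
proof -

  \<comment> \<open>The punctured ball and the support of \<open>u\<close>\<close>
  define I where "I = einterval 0 R"
  define \<Omega> where "\<Omega> = hball x0 R - {x0}"
  define K where "K = closure {x. u x \<noteq> 0}"
  obtain M where M: "DIM('a) = M + 2" using dim by (metis le_add_diff_inverse2)
  define n where "n = real (N - 1)"
  have nN: "n = real N - 1" "n = real (M + 1)" "n + 1 = real (M + 2)"
    using dim by (simp_all add: n_def N_def M)
  have I: "open I" by (simp add: I_def)
  have Ipos: "0 < r" if "r \<in> I" for r using that by (simp add: I_def einterval_iff)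
  have \<Omega>_iff: "x \<in> \<Omega> \<longleftrightarrow> x \<in> hyp_space \<and> d x \<in> I" for x
    using hdist_pos [OF pole, of x] hdist_self [OF pole]
    by (auto simp: \<Omega>_def hball_def I_def einterval_iff d_def)
  have \<Omega>: "\<Omega> \<subseteq> hyp_space - {x0}" by (auto simp: \<Omega>_def hball_def)
  have \<Omega>h: "\<Omega> \<subseteq> hyp_space" using \<Omega> by auto
  have \<Omega>x: "x \<in> hyp_space" "x \<noteq> x0" "d x \<in> I" if "x \<in> \<Omega>" for x using that \<Omega> \<Omega>_iff by auto
  have "\<Omega> = d -` I \<inter> hyp_space" using \<Omega>_iff by auto
  then have open\<Omega>: "open \<Omega>"
    using continuous_on_open_vimage [OF open_hyp_space] continuous_on_hdist [OF pole] I by (metis d_def)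
  have d\<Omega>: "continuous_on \<Omega> d" unfolding d_def by (rule continuous_on_subset [OF continuous_on_hdist [OF pole] \<Omega>h])
  have K: "compact K" "K \<subseteq> \<Omega>" and u2: "Ck_on (Suc (Suc 0)) u \<Omega>"
    using test unfolding test_functions_def K_def \<Omega>_def by blast+
  have uK: "u x = 0" if "x \<notin> K" for x using that closure_subset [of "{x. u x \<noteq> 0}"] by (auto simp: K_def)

  \<comment> \<open>Regularity of the profile \<open>\<phi>\<close> on \<open>(0, R)\<close>\<close>
  obtain \<gamma> \<gamma>1 \<gamma>2 where \<gamma>: "\<And>r. 0 \<le> r \<Longrightarrow> \<gamma> r \<in> hyp_space" "\<And>r. 0 \<le> r \<Longrightarrow> d (\<gamma> r) = r"
    "\<And>r. (\<gamma> has_vector_derivative \<gamma>1 r) (at r)" "\<And>r. (\<gamma>1 has_vector_derivative \<gamma>2 r) (at r)" "continuous_on UNIV \<gamma>2"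
    using geodesic_ray_exists [OF pole dim] unfolding d_def by metis
  have "\<gamma> r \<in> \<Omega>" "\<phi> r = u (\<gamma> r)" if "r \<in> I" for r
    using \<gamma>(1,2) [of r] Ipos [OF that] that radial by (auto simp: \<Omega>_iff)
  then obtain \<phi>1 \<phi>2 where \<phi>1: "\<And>r. r \<in> I \<Longrightarrow> (\<phi> has_real_derivative \<phi>1 r) (at r)"
    and \<phi>2: "\<And>r. r \<in> I \<Longrightarrow> (\<phi>1 has_real_derivative \<phi>2 r) (at r)" and cont\<phi>2: "continuous_on I \<phi>2"
    using C2_along_curve [OF u2 I _ \<gamma>(3,4) continuous_on_subset [OF \<gamma>(5)]] by (metis subset_UNIV)
  have cont\<phi>1: "continuous_on I \<phi>1"
    by (intro continuous_at_imp_continuous_on ballI DERIV_isCont [OF \<phi>2])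
  have deriv\<phi>: "deriv \<phi> r = \<phi>1 r" if "r \<in> I" for r by (rule DERIV_imp_deriv [OF \<phi>1 [OF that]])

  \<comment> \<open>Regularity of the coefficients, and the Bessel equation for
    \<open>V f'\<close>\<close>
  define V' where "V' = deriv V"
  define f' where "f' = deriv f"
  have N1: "N - 1 = Suc M" using M by (simp add: N_def)
  have C1: "(\<lambda>r. r ^ Suc M * V r) C1_differentiable_on I" "(\<lambda>r. r ^ Suc M * W r) C1_differentiable_on I"
    "f C1_differentiable_on I"
    using bessel solution unfolding bessel_pair_def positive_solution_def I_def N1 by blast+
  note dP = C1_differentiable_on_open_deriv [OF C1(1) I]
  have dV0: "(V has_real_derivative deriv (\<lambda>r. r ^ Suc M * V r) r / r ^ Suc M - real (Suc M) / r * V r) (at r)"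
    if "r \<in> I" for r
    by (rule has_real_derivative_cancel_power [OF dP(1) [OF that] Ipos [OF that]])
  then have V'_eq: "V' r = deriv (\<lambda>r. r ^ Suc M * V r) r / r ^ Suc M - real (Suc M) / r * V r" if "r \<in> I" for r
    unfolding V'_def using that by (intro DERIV_imp_deriv)
  have dV: "(V has_real_derivative V' r) (at r)" if "r \<in> I" for r
    using dV0 V'_eq that by simp
  have contV: "continuous_on I V"
    by (intro continuous_at_imp_continuous_on ballI DERIV_isCont [OF dV])
  have contV': "continuous_on I V'"
  proof (rule continuous_on_eq)
    show "continuous_on I (\<lambda>r. deriv (\<lambda>r. r ^ Suc M * V r) r / r ^ Suc M - real (Suc M) / r * V r)"
      using Ipos by (intro continuous_intros dP(2) contV) force+
  qed (simp add: V'_eq)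
  have contW: "continuous_on I W"
  proof (rule continuous_on_eq)
    show "continuous_on I (\<lambda>r. (r ^ Suc M * W r) / r ^ Suc M)"
      using Ipos by (intro continuous_on_divide C1_differentiable_imp_continuous_on [OF C1(2)] continuous_intros) force
  qed (use Ipos in force)
  have fpos: "0 < f r" if "r \<in> I" for r using solution that by (auto simp: positive_solution_def I_def)
  have df: "(f has_real_derivative f' r) (at r)" if "r \<in> I" for r
    unfolding f'_def by (rule C1_differentiable_on_open_deriv(1) [OF C1(3) I that])
  have contf': "continuous_on I f'"
    unfolding f'_def by (rule C1_differentiable_on_open_deriv(2) [OF C1(3) I])
  have contf: "continuous_on I f"
    by (intro continuous_at_imp_continuous_on ballI DERIV_isCont [OF df])
  define Q where "Q r = V r * f' r" for r
  have dQ: "(Q has_real_derivative - W r * f r - n / r * (V r * f' r)) (at r)" if r: "r \<in> I" for r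
  proof -
    have "(\<lambda>s. s ^ Suc M * V s * f' s) differentiable (at r)"
      and ode: "deriv (\<lambda>s. s ^ Suc M * V s * f' s) r + r ^ Suc M * W r * f r = 0"
      using solution r unfolding positive_solution_def I_def N1 f'_def by blast+
    then have "((\<lambda>s. s ^ Suc M * V s * f' s) has_real_derivative deriv (\<lambda>s. s ^ Suc M * V s * f' s) r) (at r)"
      by (simp add: DERIV_deriv_iff_real_differentiable)
    then have "((\<lambda>s. s ^ Suc M * Q s) has_real_derivative - (r ^ Suc M * W r * f r)) (at r)"
      using eq_neg_iff_add_eq_0 [THEN iffD2, OF ode] by (simp only: Q_def mult.assoc)
    from has_real_derivative_cancel_power [OF this Ipos [OF r]] show ?thesis
      by (rule DERIV_cong) (use Ipos [OF r] nN(2) in \<open>simp add: Q_def\<close>)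
  qed

  \<comment> \<open>The radial field and the five integrands as functions of
    \<open>r\<close>\<close>
  define h where "h r = n * V r * (\<phi>1 r)\<^sup>2 * cosh r / (sinh r)\<^sup>2 + Q r * (\<phi>1 r)\<^sup>2 / (sinh r * f r)" for r
  \<comment> \<open>The Bessel equation is already substituted and \<open>Q\<close> unfolded, so
    that this matches the bracket in \<open>integrand_identity\<close> literally.\<close>
  define h' where "h' r = n * (V' r * (\<phi>1 r)\<^sup>2 * cosh r / (sinh r)\<^sup>2 + 2 * V r * \<phi>1 r * \<phi>2 r * cosh r / (sinh r)\<^sup>2
       + V r * (\<phi>1 r)\<^sup>2 * (1 / sinh r - 2 * (cosh r)\<^sup>2 / sinh r ^ 3))
     + ((- W r * f r - n / r * (V r * f' r)) * (\<phi>1 r)\<^sup>2 / (sinh r * f r) + 2 * (V r * f' r) * \<phi>1 r * \<phi>2 r / (sinh r * f r)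
         - (V r * f' r) * (\<phi>1 r)\<^sup>2 * cosh r / ((sinh r)\<^sup>2 * f r) - (V r * f' r) * (\<phi>1 r)\<^sup>2 * f' r / (sinh r * (f r)\<^sup>2))" for r
  define g1 where "g1 r = V r * (\<phi>2 r + n * \<phi>1 r * cosh r / sinh r)\<^sup>2" for r
  define g2 where "g2 r = W r * (\<phi>1 r)\<^sup>2" for r
  define g3 where "g3 r = (V r / (sinh r)\<^sup>2 - V' r * cosh r / sinh r) * (\<phi>1 r)\<^sup>2" for r
  define g4 where "g4 r = V r * (f' r / f r) * (cosh r / sinh r - 1 / r) * (\<phi>1 r)\<^sup>2" for r
  define g5 where "g5 r = V r * (f r)\<^sup>2 * (\<phi>2 r / f r - \<phi>1 r * f' r / (f r)\<^sup>2)\<^sup>2" for r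
  have nz: "sinh r \<noteq> 0" "f r \<noteq> 0" "r \<noteq> 0" if "r \<in> I" for r
    using Ipos [OF that] fpos [OF that] by auto
  have dh: "(h has_real_derivative h' r) (at r)" if r: "r \<in> I" for r
  proof -
    have A: "((\<lambda>r. cosh r / (sinh r)\<^sup>2) has_real_derivative (1 / sinh r - 2 * (cosh r)\<^sup>2 / sinh r ^ 3)) (at r)"
    proof -
      have "((\<lambda>r. cosh r / (sinh r)\<^sup>2) has_real_derivative
          (sinh r * (sinh r)\<^sup>2 - cosh r * (2 * sinh r * cosh r)) / ((sinh r)\<^sup>2 * (sinh r)\<^sup>2)) (at r)"
        using nz [OF r] by (intro DERIV_divide) (auto intro!: derivative_eq_intros)
      then show ?thesis
        by (rule DERIV_cong) (use nz [OF r] in \<open>simp add: field_simps power2_eq_square power3_eq_cube\<close>)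
    qed
    have B: "((\<lambda>r. 1 / (sinh r * f r)) has_real_derivative (- cosh r / ((sinh r)\<^sup>2 * f r) - f' r / (sinh r * (f r)\<^sup>2))) (at r)"
    proof -
      have "((\<lambda>r. 1 / (sinh r * f r)) has_real_derivative
          (0 * (sinh r * f r) - 1 * (cosh r * f r + f' r * sinh r)) / ((sinh r * f r) * (sinh r * f r))) (at r)"
        using nz [OF r] by (intro DERIV_divide DERIV_mult df r) (auto intro!: derivative_eq_intros)
      then show ?thesis
        by (rule DERIV_cong) (use nz [OF r] in \<open>simp add: field_simps power2_eq_square\<close>)
    qed
    have sq: "((\<lambda>r. (\<phi>1 r)\<^sup>2) has_real_derivative 2 * \<phi>1 r * \<phi>2 r) (at r)"
      by (rule derivative_eq_intros \<phi>2 r refl)+ simp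
    have "((\<lambda>r. n * (V r * (\<phi>1 r)\<^sup>2 * (cosh r / (sinh r)\<^sup>2)) + Q r * (\<phi>1 r)\<^sup>2 * (1 / (sinh r * f r))) has_real_derivative
      n * ((V' r * (\<phi>1 r)\<^sup>2 + 2 * \<phi>1 r * \<phi>2 r * V r) * (cosh r / (sinh r)\<^sup>2)
           + (1 / sinh r - 2 * (cosh r)\<^sup>2 / sinh r ^ 3) * (V r * (\<phi>1 r)\<^sup>2))
      + (((- W r * f r - n / r * (V r * f' r)) * (\<phi>1 r)\<^sup>2 + 2 * \<phi>1 r * \<phi>2 r * Q r) * (1 / (sinh r * f r))
           + (- cosh r / ((sinh r)\<^sup>2 * f r) - f' r / (sinh r * (f r)\<^sup>2)) * (Q r * (\<phi>1 r)\<^sup>2))) (at r)"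
      by (intro DERIV_add DERIV_cmult DERIV_mult A B sq dV dQ r)
    moreover have "(\<lambda>r. n * (V r * (\<phi>1 r)\<^sup>2 * (cosh r / (sinh r)\<^sup>2)) + Q r * (\<phi>1 r)\<^sup>2 * (1 / (sinh r * f r))) = h"
      by (simp add: h_def fun_eq_iff)
    moreover have "n * ((V' r * (\<phi>1 r)\<^sup>2 + 2 * \<phi>1 r * \<phi>2 r * V r) * (cosh r / (sinh r)\<^sup>2)
           + (1 / sinh r - 2 * (cosh r)\<^sup>2 / sinh r ^ 3) * (V r * (\<phi>1 r)\<^sup>2))
      + (((- W r * f r - n / r * (V r * f' r)) * (\<phi>1 r)\<^sup>2 + 2 * \<phi>1 r * \<phi>2 r * Q r) * (1 / (sinh r * f r))
           + (- cosh r / ((sinh r)\<^sup>2 * f r) - f' r / (sinh r * (f r)\<^sup>2)) * (Q r * (\<phi>1 r)\<^sup>2)) = h' r"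
      unfolding h'_def Q_def by (simp add: ring_distribs add_divide_distrib diff_divide_distrib mult_ac)
    ultimately show ?thesis by simp
  qed
  have cont: "continuous_on I h'" "continuous_on I g1" "continuous_on I g2" "continuous_on I g3"
    "continuous_on I g4" "continuous_on I g5"
    unfolding h'_def g1_def g2_def g3_def g4_def g5_def
    using nz by (auto intro!: continuous_intros contV contV' contW contf contf' cont\<phi>1 cont\<phi>2)

  \<comment> \<open>First \<open>\<phi>1\<close> vanishes off \<open>K\<close> because
    \<open>\<phi>\<close> does, then \<open>\<phi>2\<close> because \<open>\<phi>1\<close> does.
    Each of \<open>h\<close> and \<open>g1\<close> to \<open>g5\<close> has a factor that then
    vanishes.\<close>
  have zero: "\<phi>1 (d x) = 0" "\<phi>2 (d x) = 0" if x: "x \<in> \<Omega> - K" for x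
  proof -
    have T: "open (\<Omega> - K)" "\<Omega> - K \<subseteq> hyp_space - {x0}"
      using open\<Omega> K(1) \<Omega> by (auto intro: open_Diff compact_imp_closed)
    have "\<phi> (hdist x0 y) = 0" if "y \<in> \<Omega> - K" for y using that uK radial \<Omega>h by (force simp: d_def)
    then have z: "\<phi>1 (hdist x0 y) = 0" if "y \<in> \<Omega> - K" for y
      using radial_deriv_eq_0 [OF pole T that _ \<phi>1] \<Omega>x(3) that by (auto simp: d_def)
    then show "\<phi>1 (d x) = 0" using x by (simp add: d_def)
    show "\<phi>2 (d x) = 0"
      using radial_deriv_eq_0 [OF pole T x z \<phi>2] \<Omega>x(3) x by (auto simp: d_def)
  qed
  \<comment> \<open>Integrability of each term permits splitting the integral of the sum
    below.\<close>
  have int: "set_integrable hvol \<Omega> (\<lambda>x. g1 (d x))" "set_integrable hvol \<Omega> (\<lambda>x. g2 (d x))"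
    "set_integrable hvol \<Omega> (\<lambda>x. g3 (d x))" "set_integrable hvol \<Omega> (\<lambda>x. g4 (d x))" "set_integrable hvol \<Omega> (\<lambda>x. g5 (d x))"
  proof -
    have sub: "d ` \<Omega> \<subseteq> I" using \<Omega>x by auto
    have gen: "set_integrable hvol \<Omega> (\<lambda>x. g (d x))" if "continuous_on I g" "\<And>x. x \<in> \<Omega> - K \<Longrightarrow> g (d x) = 0" for g :: "real \<Rightarrow> real"
      by (rule set_integrable_hvol_compact_support [OF open\<Omega> \<Omega>h K continuous_on_compose2 [OF that(1) d\<Omega> sub]])
         (use that(2) in auto)
    show "set_integrable hvol \<Omega> (\<lambda>x. g1 (d x))" by (rule gen [OF cont(2)]) (simp add: g1_def zero)
    show "set_integrable hvol \<Omega> (\<lambda>x. g2 (d x))" by (rule gen [OF cont(3)]) (simp add: g2_def zero)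
    show "set_integrable hvol \<Omega> (\<lambda>x. g3 (d x))" by (rule gen [OF cont(4)]) (simp add: g3_def zero)
    show "set_integrable hvol \<Omega> (\<lambda>x. g4 (d x))" by (rule gen [OF cont(5)]) (simp add: g4_def zero)
    show "set_integrable hvol \<Omega> (\<lambda>x. g5 (d x))" by (rule gen [OF cont(6)]) (simp add: g5_def zero)
  qed
  have "(LINT x:\<Omega>|hvol. h' (d x) * sinh (d x) + real (M + 2) * h (d x) * cosh (d x)) = 0"
    unfolding d_def
  proof (rule radial_divergence_theorem [OF pole M open\<Omega> \<Omega> K])
    show "(h has_real_derivative h' (hdist x0 x)) (at (hdist x0 x))" if "x \<in> \<Omega>" for x
      using dh \<Omega>x(3) [OF that] by (simp add: d_def)
    show "continuous_on (hdist x0 ` \<Omega>) h'"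
      by (rule continuous_on_subset [OF cont(1)]) (use \<Omega>x(3) in \<open>auto simp: d_def\<close>)
    show "h (hdist x0 x) = 0" if "x \<in> \<Omega> - K" for x using zero [OF that] by (simp add: h_def d_def)
  qed
  moreover have "(LINT x:\<Omega>|hvol. h' (d x) * sinh (d x) + real (M + 2) * h (d x) * cosh (d x))
     = (LINT x:\<Omega>|hvol. g1 (d x) - (g2 (d x) + n * g3 (d x) - n * g4 (d x) + g5 (d x)))"
  proof -
    have "h' r * sinh r + (n + 1) * h r * cosh r = g1 r - (g2 r + n * g3 r - n * g4 r + g5 r)" if "r \<in> I" for r
      unfolding h'_def h_def Q_def g1_def g2_def g3_def g4_def g5_def
      by (rule integrand_identity) (use nz [OF that] in \<open>auto simp: cosh_square_eq\<close>)
    then show ?thesis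
      unfolding set_lebesgue_integral_def nN(3) [symmetric] using \<Omega>x(3)
      by (intro Bochner_Integration.integral_cong) (auto simp: indicator_def)
  qed
  ultimately have main: "(LINT x:\<Omega>|hvol. g1 (d x)) = (LINT x:\<Omega>|hvol. g2 (d x)) + n * (LINT x:\<Omega>|hvol. g3 (d x))
     - n * (LINT x:\<Omega>|hvol. g4 (d x)) + (LINT x:\<Omega>|hvol. g5 (d x))"
    using int by simp

  \<comment> \<open>Identification with the integrals of the statement\<close>
  have conv: "(LINT x:hball x0 R|hvol. F x) = (LINT x:\<Omega>|hvol. g (d x))" if "\<And>x. x \<in> \<Omega> \<Longrightarrow> F x = g (d x)"
    for F :: "'a \<Rightarrow> real" and g :: "real \<Rightarrow> real"
    unfolding set_integral_hvol_remove_point [OF pole, of "hball x0 R"] \<Omega>_def [symmetric]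
    unfolding set_lebesgue_integral_def
    by (rule Bochner_Integration.integral_cong) (auto simp: indicator_def that)
  have grad: "(hnorm x (hgrad u x))\<^sup>2 = (\<phi>1 (d x))\<^sup>2" if x: "x \<in> \<Omega>" for x
  proof -
    have D: "((\<lambda>y. \<phi> (hdist x0 y)) has_derivative
        (\<lambda>v. (\<phi>1 (d x) / sinh (d x)) *\<^sub>R hcosh_grad x0 x \<bullet> v)) (at x)"
      using has_derivative_radial [OF pole \<Omega>x(1,2) [OF x], of \<phi>] \<phi>1 [OF \<Omega>x(3) [OF x]] by (simp add: d_def)
    then have "(u has_derivative (\<lambda>v. (\<phi>1 (d x) / sinh (d x)) *\<^sub>R hcosh_grad x0 x \<bullet> v)) (at x)"
      by (rule has_derivative_transform_within_open [OF _ open_hyp_space \<Omega>x(1) [OF x]])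
         (use radial in \<open>simp add: d_def\<close>)
    then have "hgrad u x = hgrad (\<lambda>y. \<phi> (hdist x0 y)) x"
      using hgrad_eq [OF D] hgrad_eq by metis
    then show ?thesis
      using hnorm_hgrad_radial [OF pole \<Omega>x(1,2) [OF x], of \<phi>] \<phi>1 [OF \<Omega>x(3) [OF x]] by (simp add: d_def)
  qed
  have lap: "hlaplacian u x = \<phi>2 (d x) + n * \<phi>1 (d x) * cosh (d x) / sinh (d x)" if x: "x \<in> \<Omega>" for x
    unfolding nN(2) d_def
    by (rule hlaplacian_radial [OF pole M open\<Omega> \<Omega> x])
       (use radial \<phi>1 \<phi>2 \<Omega>x x in \<open>auto simp: d_def\<close>)
  have last: "(hnorm x (hgrad (\<lambda>y. u\<^sub>r y / f (d y)) x))\<^sup>2 = (\<phi>2 (d x) / f (d x) - \<phi>1 (d x) * f' (d x) / (f (d x))\<^sup>2)\<^sup>2"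
    if x: "x \<in> \<Omega>" for x
  proof -
    have "((\<lambda>r. \<phi>1 r / f r) has_real_derivative
        (\<phi>2 (d x) * f (d x) - \<phi>1 (d x) * f' (d x)) / (f (d x) * f (d x))) (at (d x))"
      by (intro DERIV_divide df \<phi>2 \<Omega>x(3) x nz)
    then have "((\<lambda>r. \<phi>1 r / f r) has_real_derivative (\<phi>2 (d x) / f (d x) - \<phi>1 (d x) * f' (d x) / (f (d x))\<^sup>2)) (at (d x))"
      by (rule DERIV_cong) (use nz [OF \<Omega>x(3) [OF x]] in \<open>simp add: diff_divide_distrib power2_eq_square\<close>)
    \<comment> \<open>\<open>u\<^sub>r\<close> is defined through \<open>deriv \<phi>\<close>, which
      agrees with \<open>\<phi>1\<close> on the open interval \<open>I\<close>; that suffices for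
      the derivative at \<open>d x\<close>.\<close>
    then have "((\<lambda>r. deriv \<phi> r / f r) has_real_derivative (\<phi>2 (d x) / f (d x) - \<phi>1 (d x) * f' (d x) / (f (d x))\<^sup>2)) (at (d x))"
      by (rule has_field_derivative_transform_within_open [OF _ I \<Omega>x(3) [OF x]]) (simp add: deriv\<phi>)
    from hnorm_hgrad_radial [OF pole \<Omega>x(1,2) [OF x] this [unfolded d_def]]
    show ?thesis by (simp add: u\<^sub>r_def d_def)
  qed
  have "(LINT x:hball x0 R|hvol. V (d x) * \<bar>hlaplacian u x\<bar>\<^sup>2) = (LINT x:\<Omega>|hvol. g1 (d x))"
    by (rule conv) (simp add: lap g1_def)
  moreover have "(LINT x:hball x0 R|hvol. W (d x) * (hnorm x (hgrad u x))\<^sup>2) = (LINT x:\<Omega>|hvol. g2 (d x))"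
    by (rule conv) (simp add: grad g2_def)
  moreover have "(LINT x:hball x0 R|hvol. (V (d x) / (sinh (d x))\<^sup>2 - deriv V (d x) * cosh (d x) / sinh (d x))
          * (hnorm x (hgrad u x))\<^sup>2) = (LINT x:\<Omega>|hvol. g3 (d x))"
    by (rule conv) (simp add: grad g3_def V'_def)
  moreover have "(LINT x:hball x0 R|hvol. V (d x) * (deriv f (d x) / f (d x)) * (cosh (d x) / sinh (d x) - 1 / d x)
          * (hnorm x (hgrad u x))\<^sup>2) = (LINT x:\<Omega>|hvol. g4 (d x))"
    by (rule conv) (simp add: grad g4_def f'_def)
  moreover have "(LINT x:hball x0 R|hvol. V (d x) * (f (d x))\<^sup>2 * (hnorm x (hgrad (\<lambda>y. u\<^sub>r y / f (d y)) x))\<^sup>2)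
      = (LINT x:\<Omega>|hvol. g5 (d x))"
    by (rule conv) (simp add: last g5_def)
  ultimately show ?thesis using main nN(1) by simp
qed

end
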